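(* Suppose that $\delta_s+\theta_{s,s}+\theta_{s,2s}<1$ (the restricted isometry property). Then, for every $S$ with $|S|=s$, $$\phi(S,2s)\Lambda(S,s)\ge(1-\delta_s-\theta_{s,s}-\theta_{s,2s})\sqrt{\frac{1-\delta_s}{1-\delta_s-\theta_{s,s}}}\ge1-\delta_s-\theta_{s,s}-\theta_{s,2s},$$ and consequently $$\alpha(S)\le\frac{\sqrt2\,(\theta_{s,s}+\sqrt{\theta_{s,s}})}{1-\delta_s-\theta_{s,s}-\theta_{s,2s}} .$$ For example, if $\delta_s\le\sqrt2-1$ and $\theta_{s,2s}\le\frac1{16}$, then $\alpha(S)\le0.96$. Hence, the RIP with such small constants implies the weak $(S,2s)$-irrepresentable condition: for all $\tau_S\in\{-1,1\}^s$ there exist $\mathcal N\supset S$ with $|\mathcal N|\le2s$ and $\Sigma_{1,1}(\mathcal N)$ non-singular, and $\tau_{\mathcal N\setminus S}\in\{-1,1\}^{|\mathcal N\setminus S|}$, such that $\|\Sigma_{2,1}(\mathcal N)\Sigma_{1,1}^{-1}(\mathcal N)\tau_{\mathcal N}\|_\infty\le1$, where $\tau_{\mathcal N}$ is composed of $\tau_S$ and $\tau_{\mathcal N\setminus S}$.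
   Context: $Q$ is a probability measure on a measurable space, $\psi_1,\dots,\psi_p\in L_2(Q)$ are real functions, $(\cdot,\cdot)$ and $\|\cdot\|$ are the inner product and norm of $L_2(Q)$, and $f_\beta:=\sum_{j=1}^p\beta_j\psi_j$ for $\beta\in\mathbb{R}^p$. The Gram matrix is $\Sigma=(\sigma_{j,k})$, $\sigma_{j,k}:=(\psi_j,\psi_k)$. $S\subset\{1,\dots,p\}$ is an index set with $|S|=s\ge1$. $\beta_{\mathcal N}$ is the vector with entries $\beta_j1\{j\in\mathcal N\}$. $\Sigma_{1,1}(\mathcal N):=(\sigma_{j,k})_{j,k\in\mathcal N}$, $\Sigma_{2,1}(\mathcal N):=(\sigma_{j,k})_{j\notin\mathcal N,k\in\mathcal N}$. $\Lambda(S,s)\ge 0$ is the square root of the smallest eigenvalue of $\Sigma_{1,1}(S)$. The norm $\|\cdot\|_\infty$ of an empty vector is $0$. Restricted isometry constant: $\delta_s$ is the smallest value such that $(1-\delta_s)\|\beta_{\mathcal N}\|_2^2\le\|f_{\beta_{\mathcal N}}\|^2\le(1+\delta_s)\|\beta_{\mathcal N}\|_2^2$ for all $\beta$ and all $\mathcal N$ with $|\mathcal N|\le s$. Restricted orthogonality constants: for $N\ge s$, $\theta(S,N)$ is the supremum of $|(f_{\beta_{\mathcal N}},f_{\beta_{\mathcal M}})|/(\|\beta_{\mathcal N}\|_2\|\beta_{\mathcal M}\|_2)$ over all $\mathcal N\supset S$ with $|\mathcal N|\le N$, all $\mathcal M\subset\mathcal N^c$ with $|\mathcal M|\le s$, and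 all $\beta$ with $\beta_{\mathcal N},\beta_{\mathcal M}\ne0$; and $\theta_{s,N}:=\max\{\theta(S,N):|S|=s\}$. For $\mathcal N\supset S$ let $\mathcal R(S,\mathcal N)$ be the set of $\beta\in\mathbb{R}^p$ with $\|\beta_{S^c}\|_1\le\|\beta_S\|_1\ne0$ and, if $\mathcal N\ne S$, $\|\beta_{\mathcal N^c}\|_\infty\le\min_{j\in\mathcal N\setminus S}|\beta_j|$ (no second condition if $\mathcal N=S$). $\phi(S,2s)\ge0$ is defined by $$\phi^2(S,2s):=\inf\left\{\frac{\|f_\beta\|^2}{\|\beta_{\mathcal N}\|_2^2}:\ \mathcal N\supset S,\ |\mathcal N|\le2s,\ \beta\in\mathcal R(S,\mathcal N)\right\}.$$ Finally $$\alpha(S):=\frac{\sqrt2\,\theta(S,s)+\sqrt{(1+\delta_s)\theta(S,s)}}{\phi(S,2s)\Lambda(S,s)} .$$ *)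

theory Defs
  imports
    "HOL-Probability.Probability"
    "Jordan_Normal_Form.DL_Submatrix"
    "Jordan_Normal_Form.Gauss_Jordan_Elimination"
    "Jordan_Normal_Form.Spectral_Radius"
begin

unbundle no vec_syntax
no_notation inner (infix "\<bullet>" 70)

text \<open>
  The index set \<open>{1,\<dots>,p}\<close> is rendered as \<open>{..<p}\<close>; vectors and matrices are the
  dimension-carrying ones of the entry Jordan Normal Form.  Elements of \<open>L\<^sub>2(Q)\<close> are represented
  by functions.
\<close>

definition norm1 :: "real vec \<Rightarrow> real" where
  "norm1 v = (\<Sum>j<dim_vec v. \<bar>v $ j\<bar>)"

definition norm2 :: "real vec \<Rightarrow> real" where
  "norm2 v = sqrt (v \<bullet> v)"

text \<open>Inserting \<open>0\<close> changes the maximum only for the empty vector, whose norm is \<open>0\<close>.\<close>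

definition norm_inf :: "real vec \<Rightarrow> real" where
  "norm_inf v = Max (insert 0 ((\<lambda>j. \<bar>v $ j\<bar>) ` {..<dim_vec v}))"

definition restr :: "real vec \<Rightarrow> nat set \<Rightarrow> real vec" where
  "restr \<beta> N = vec (dim_vec \<beta>) (\<lambda>j. if j \<in> N then \<beta> $ j else 0)"

definition L2_dictionary :: "'a measure \<Rightarrow> nat \<Rightarrow> (nat \<Rightarrow> 'a \<Rightarrow> real) \<Rightarrow> bool" where
  "L2_dictionary Q p \<psi> \<longleftrightarrow> prob_space Q \<and>
     (\<forall>j<p. \<psi> j \<in> borel_measurable Q \<and> integrable Q (\<lambda>x. (\<psi> j x)\<^sup>2))"

definition ipQ :: "'a measure \<Rightarrow> ('a \<Rightarrow> real) \<Rightarrow> ('a \<Rightarrow> real) \<Rightarrow> real" where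
  "ipQ Q f g = (\<integral>x. f x * g x \<partial>Q)"

definition normQ :: "'a measure \<Rightarrow> ('a \<Rightarrow> real) \<Rightarrow> real" where
  "normQ Q f = sqrt (ipQ Q f f)"

definition lincomb_fun :: "(nat \<Rightarrow> 'a \<Rightarrow> real) \<Rightarrow> real vec \<Rightarrow> 'a \<Rightarrow> real" where
  "lincomb_fun \<psi> \<beta> x = (\<Sum>j<dim_vec \<beta>. \<beta> $ j * \<psi> j x)"

definition Gram :: "'a measure \<Rightarrow> nat \<Rightarrow> (nat \<Rightarrow> 'a \<Rightarrow> real) \<Rightarrow> real mat" where
  "Gram Q p \<psi> = mat p p (\<lambda>(j, k). ipQ Q (\<psi> j) (\<psi> k))"

text \<open>\<open>submatrix\<close> and \<open>pick\<close> both list an index set in increasing order.\<close>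

definition Sigma11 :: "'a measure \<Rightarrow> nat \<Rightarrow> (nat \<Rightarrow> 'a \<Rightarrow> real) \<Rightarrow> nat set \<Rightarrow> real mat" where
  "Sigma11 Q p \<psi> N = submatrix (Gram Q p \<psi>) N N"

definition Sigma21 :: "'a measure \<Rightarrow> nat \<Rightarrow> (nat \<Rightarrow> 'a \<Rightarrow> real) \<Rightarrow> nat set \<Rightarrow> real mat" where
  "Sigma21 Q p \<psi> N = submatrix (Gram Q p \<psi>) ({..<p} - N) N"

definition entries :: "(nat \<Rightarrow> real) \<Rightarrow> nat set \<Rightarrow> real vec" where
  "entries \<tau> N = vec (card N) (\<lambda>i. \<tau> (pick N i))"

definition Lambda :: "'a measure \<Rightarrow> nat \<Rightarrow> (nat \<Rightarrow> 'a \<Rightarrow> real) \<Rightarrow> nat set \<Rightarrow> real" where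
  "Lambda Q p \<psi> S = sqrt (Min (spectrum (Sigma11 Q p \<psi> S)))"

definition RIC :: "'a measure \<Rightarrow> nat \<Rightarrow> (nat \<Rightarrow> 'a \<Rightarrow> real) \<Rightarrow> nat \<Rightarrow> real" where
  "RIC Q p \<psi> s = (LEAST d. \<forall>\<beta>\<in>carrier_vec p. \<forall>N\<subseteq>{..<p}. card N \<le> s \<longrightarrow>
     (1 - d) * (norm2 (restr \<beta> N))\<^sup>2 \<le> (normQ Q (lincomb_fun \<psi> (restr \<beta> N)))\<^sup>2 \<and>
     (normQ Q (lincomb_fun \<psi> (restr \<beta> N)))\<^sup>2 \<le> (1 + d) * (norm2 (restr \<beta> N))\<^sup>2)"

text \<open>
  All quotients are nonnegative, so inserting \<open>0\<close> changes the supremum only when no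
  admissible triple \<open>(N, M, \<beta>)\<close> exists (i.e. \<open>S\<close> is the whole index set); it is then \<open>0\<close>.
\<close>

definition ROC_set :: "'a measure \<Rightarrow> nat \<Rightarrow> (nat \<Rightarrow> 'a \<Rightarrow> real) \<Rightarrow> nat \<Rightarrow> nat set \<Rightarrow> nat \<Rightarrow> real" where
  "ROC_set Q p \<psi> s S n = Sup (insert 0
     {\<bar>ipQ Q (lincomb_fun \<psi> (restr \<beta> N)) (lincomb_fun \<psi> (restr \<beta> M))\<bar> /
        (norm2 (restr \<beta> N) * norm2 (restr \<beta> M)) | N M \<beta>.
      S \<subseteq> N \<and> N \<subseteq> {..<p} \<and> card N \<le> n \<and> M \<subseteq> {..<p} - N \<and> card M \<le> s \<and>
      \<beta> \<in> carrier_vec p \<and> restr \<beta> N \<noteq> 0\<^sub>v p \<and> restr \<beta> M \<noteq> 0\<^sub>v p})"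

definition ROC :: "'a measure \<Rightarrow> nat \<Rightarrow> (nat \<Rightarrow> 'a \<Rightarrow> real) \<Rightarrow> nat \<Rightarrow> nat \<Rightarrow> real" where
  "ROC Q p \<psi> s n = Max {ROC_set Q p \<psi> s S n | S. S \<subseteq> {..<p} \<and> card S = s}"

definition Rset :: "nat \<Rightarrow> nat set \<Rightarrow> nat set \<Rightarrow> real vec set" where
  "Rset p S N = {\<beta> \<in> carrier_vec p.
     norm1 (restr \<beta> ({..<p} - S)) \<le> norm1 (restr \<beta> S) \<and> norm1 (restr \<beta> S) \<noteq> 0 \<and>
     (N \<noteq> S \<longrightarrow> norm_inf (restr \<beta> ({..<p} - N)) \<le> Min ((\<lambda>j. \<bar>\<beta> $ j\<bar>) ` (N - S)))}"

definition phi :: "'a measure \<Rightarrow> nat \<Rightarrow> (nat \<Rightarrow> 'a \<Rightarrow> real) \<Rightarrow> nat set \<Rightarrow> nat \<Rightarrow> real" where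
  "phi Q p \<psi> S n = sqrt (Inf {(normQ Q (lincomb_fun \<psi> \<beta>))\<^sup>2 / (norm2 (restr \<beta> N))\<^sup>2 | N \<beta>.
     S \<subseteq> N \<and> N \<subseteq> {..<p} \<and> card N \<le> n \<and> \<beta> \<in> Rset p S N})"

definition alpha :: "'a measure \<Rightarrow> nat \<Rightarrow> (nat \<Rightarrow> 'a \<Rightarrow> real) \<Rightarrow> nat \<Rightarrow> nat set \<Rightarrow> real" where
  "alpha Q p \<psi> s S =
     (sqrt 2 * ROC_set Q p \<psi> s S s + sqrt ((1 + RIC Q p \<psi> s) * ROC_set Q p \<psi> s S s)) /
     (phi Q p \<psi> S (2 * s) * Lambda Q p \<psi> S)"

definition weak_irrepresentable ::
  "'a measure \<Rightarrow> nat \<Rightarrow> (nat \<Rightarrow> 'a \<Rightarrow> real) \<Rightarrow> nat set \<Rightarrow> nat \<Rightarrow> bool" where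
  "weak_irrepresentable Q p \<psi> S n \<longleftrightarrow>
     (\<forall>\<tau>\<^sub>S \<in> S \<rightarrow> {-1, 1}. \<exists>N. S \<subseteq> N \<and> N \<subseteq> {..<p} \<and> card N \<le> n \<and>
        invertible_mat (Sigma11 Q p \<psi> N) \<and>
        (\<exists>\<tau>\<^sub>2 \<in> N - S \<rightarrow> {-1, 1}.
           norm_inf (Sigma21 Q p \<psi> N *\<^sub>v (the (mat_inverse (Sigma11 Q p \<psi> N)) *\<^sub>v
             entries (\<lambda>j. if j \<in> S then \<tau>\<^sub>S j else \<tau>\<^sub>2 j) N)) \<le> 1))"

end

(*
  Minimise the limit of the Lasso objective in which the coefficients on S are so large that
  their penalty is linear: 1/2 |f_b|^2 + sum_S tau_j b_j + sum_{S^c} |b_j|. With N the union of S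
  and the support of the minimiser b, the stationarity conditions say that Sigma_11(N) (-b_N) is a
  sign vector extending tau_S and that Sigma_21(N) (-b_N) has entries of modulus at most 1, which
  is the irrepresentable condition. The minimiser exists, and has at most s nonzero entries
  outside S, because phi(S,2s) is bounded below; the lower bound comes from cutting N^c into
  blocks of s coordinates of decreasing size, using restricted orthogonality on each of them.
*)
theory Submission
  imports Defs
begin

section \<open>Sorting a vector into blocks\<close>

text \<open>The irrepresentable condition is not read off from \<open>alpha\<close> \<le> 0.96; both
  rest on the same lower bound for the Gram form. That form may be singular, so coercivity has to
  come from the cone where the l1-norm off S is at most the l1-norm on S, and every vector with
  objective value at most 0 lies in it. The real obstacle is sparsity, since the penalty alone does
  not limit how many coordinates become active. The minimiser b is therefore compared with the
  solution c of the same problem on S. The residual d = b - c is orthogonal to everything supported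
  on S, and its energy is at most (\<theta> / (1 - \<delta>)) s / \<open>\<phi>2\<close>, because
  the penalty of b off S absorbs most of the coupling with c. If s coordinates outside S were
  active, pairing b with v = - sgn b on them would give s = F v c + F v d, whereas the two terms are
  at most 0.107 s and 0.8 s.\<close>

lemma sum_abs_le_L2_set: "(\<Sum>j\<in>N. \<bar>x j\<bar>) \<le> sqrt (card N) * L2_set x N"
  using L2_set_mult_ineq[of "\<lambda>_. 1" x N] by (simp add: L2_set_constant)

lemma L2_set_le_bound:
  assumes "\<And>j. j \<in> N \<Longrightarrow> \<bar>x j\<bar> \<le> B" "0 \<le> B" "card N \<le> n"
  shows "L2_set x N \<le> sqrt n * B"
proof -
  have "L2_set x N = L2_set (\<lambda>j. \<bar>x j\<bar>) N" by (simp add: L2_set_def)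
  also have "\<dots> \<le> L2_set (\<lambda>_. B) N" using assms by (intro L2_set_mono) auto
  also have "\<dots> = sqrt (card N) * B" using assms by (simp add: L2_set_constant)
  also have "\<dots> \<le> sqrt n * B" using assms by (intro mult_right_mono) auto
  finally show ?thesis .
qed

lemma exists_largest_subset:
  fixes a :: "'b \<Rightarrow> real"
  assumes "finite T" "n \<le> card T"
  shows "\<exists>M\<subseteq>T. card M = n \<and> (\<forall>i\<in>M. \<forall>j\<in>T - M. a j \<le> a i)"
  using assms(2)
proof (induction n)
  case 0
  then show ?case by (intro exI[of _ "{}"]) auto
next
  case (Suc n)
  then obtain M where M: "M \<subseteq> T" "card M = n" "\<forall>i\<in>M. \<forall>j\<in>T - M. a j \<le> a i" by auto
  have fin: "finite (T - M)" "finite M" using assms(1) M(1) finite_subset by auto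
  have "T - M \<noteq> {}" using Suc.prems M(1,2) by auto
  then have "Max (a ` (T - M)) \<in> a ` (T - M)" using fin by (intro Max_in) auto
  then obtain k where k: "k \<in> T - M" "Max (a ` (T - M)) = a k" by (elim imageE) auto
  have max: "a j \<le> a k" if "j \<in> T - M" for j
    unfolding k(2)[symmetric] using fin that by (intro Max_ge) auto
  show ?case
  proof (intro exI[of _ "insert k M"] conjI ballI)
    show "insert k M \<subseteq> T" "card (insert k M) = Suc n" using M k fin by auto
    fix i j assume "i \<in> insert k M" "j \<in> T - insert k M"
    then show "a j \<le> a i" using M(3) max by auto
  qed
qed

text \<open>
  Peel off the \<open>s\<close> largest entries: the \<open>\<ell>\<^sub>2\<close>-norm of each block is at most the
  \<open>\<ell>\<^sub>1\<close>-norm of the preceding one divided by \<open>\<surd>s\<close>.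
\<close>

lemma subadditive_block_bound:
  fixes G :: "'b set \<Rightarrow> real"
  assumes "finite T" "0 < s" "0 \<le> C"
    and block: "\<And>M. M \<subseteq> T \<Longrightarrow> card M \<le> s \<Longrightarrow> G M \<le> C * L2_set x M"
    and subadd: "\<And>M M'. M \<subseteq> T \<Longrightarrow> M' \<subseteq> T \<Longrightarrow> M \<inter> M' = {} \<Longrightarrow> G (M \<union> M') \<le> G M + G M'"
    and B: "\<And>j. j \<in> T \<Longrightarrow> \<bar>x j\<bar> \<le> B" "0 \<le> B"
  shows "G T \<le> C * (sqrt s * B + (\<Sum>j\<in>T. \<bar>x j\<bar>) / sqrt s)"
  using assms(1) block subadd B
proof (induction "card T" arbitrary: T B rule: less_induct)
  case less
  show ?case
  proof (cases "card T \<le> s")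
    case True
    have "G T \<le> C * L2_set x T" using less.prems(2) True by auto
    also have "\<dots> \<le> C * (sqrt s * B + (\<Sum>j\<in>T. \<bar>x j\<bar>) / sqrt s)"
      using L2_set_le_bound[of T x B s] less.prems True \<open>0 \<le> C\<close>
      by (intro mult_left_mono) (auto simp: sum_nonneg intro: add_increasing2)
    finally show ?thesis .
  next
    case False
    then obtain M where M: "M \<subseteq> T" "card M = s" "\<forall>i\<in>M. \<forall>j\<in>T - M. \<bar>x j\<bar> \<le> \<bar>x i\<bar>"
      using exists_largest_subset[OF less.prems(1), of s "\<lambda>j. \<bar>x j\<bar>"] by auto
    have fM: "finite M" "M \<noteq> {}" using M \<open>0 < s\<close> less.prems(1) finite_subset by auto
    \<comment> \<open>The least modulus in the peeled block bounds every remaining entry, so it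
      takes over the role of \<open>B\<close>, and \<open>s\<close> times it is at most the l1-norm
      of that block. Only the first block, which has no predecessor, is charged to \<open>B\<close>
      itself.\<close>
    define B' where "B' = Min ((\<lambda>j. \<bar>x j\<bar>) ` M)"
    have B'0: "0 \<le> B'" unfolding B'_def using fM by auto
    have B'T: "\<bar>x j\<bar> \<le> B'" if "j \<in> T - M" for j
      unfolding B'_def using fM M(3) that by auto
    have "real (card M) * B' \<le> (\<Sum>j\<in>M. \<bar>x j\<bar>)"
      using fM by (intro sum_bounded_below) (auto simp: B'_def)
    hence B's: "sqrt s * B' \<le> (\<Sum>j\<in>M. \<bar>x j\<bar>) / sqrt s"
      using M(2) \<open>0 < s\<close> by (simp add: field_simps)
    have "card (T - M) < card T"
      using fM M less.prems(1) by (intro psubset_card_mono) auto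
    then have IH: "G (T - M) \<le> C * (sqrt s * B' + (\<Sum>j\<in>T - M. \<bar>x j\<bar>) / sqrt s)"
    proof (rule less.hyps)
      show "G N \<le> C * L2_set x N" if "N \<subseteq> T - M" "card N \<le> s" for N
        using that by (intro less.prems(2)) auto
      show "G (N \<union> N') \<le> G N + G N'" if "N \<subseteq> T - M" "N' \<subseteq> T - M" "N \<inter> N' = {}" for N N'
        using that by (intro less.prems(3)) auto
    qed (use B'0 B'T less.prems(1) in auto)
    have "G T = G (M \<union> (T - M))" using M(1) by (metis Diff_partition)
    also have "\<dots> \<le> G M + G (T - M)" using M(1) by (intro less.prems(3)) auto
    also have "G M \<le> C * (sqrt s * B)"
    proof -
      have "G M \<le> C * L2_set x M" using less.prems(2) M by auto
      also have "\<dots> \<le> C * (sqrt s * B)"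
        using less.prems(4,5) M(1,2) \<open>0 \<le> C\<close> by (intro mult_left_mono L2_set_le_bound) auto
      finally show ?thesis .
    qed
    also note IH
    also have "C * (sqrt s * B' + (\<Sum>j\<in>T - M. \<bar>x j\<bar>) / sqrt s)
        \<le> C * ((\<Sum>j\<in>M. \<bar>x j\<bar>) / sqrt s + (\<Sum>j\<in>T - M. \<bar>x j\<bar>) / sqrt s)"
      using B's \<open>0 \<le> C\<close> by (intro mult_left_mono) auto
    also have "(\<Sum>j\<in>M. \<bar>x j\<bar>) / sqrt s + (\<Sum>j\<in>T - M. \<bar>x j\<bar>) / sqrt s
        = (\<Sum>j\<in>T. \<bar>x j\<bar>) / sqrt s"
      using sum.subset_diff[OF M(1) less.prems(1), of "\<lambda>j. \<bar>x j\<bar>"]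
      by (simp add: add_divide_distrib)
    finally show ?thesis by (simp add: algebra_simps)
  qed
qed

section \<open>Quadratic forms\<close>

text \<open>Vectors are plain functions here: no dimensions to track, and compactness can be had
  from the product topology. The form reads only indices below \<open>p\<close>.\<close>

definition cutoff :: "(nat \<Rightarrow> real) \<Rightarrow> nat set \<Rightarrow> nat \<Rightarrow> real" where
  "cutoff x N = (\<lambda>j. if j \<in> N then x j else 0)"

definition mapp :: "nat \<Rightarrow> (nat \<Rightarrow> nat \<Rightarrow> real) \<Rightarrow> (nat \<Rightarrow> real) \<Rightarrow> nat \<Rightarrow> real" where
  "mapp p A x j = (\<Sum>k<p. A j k * x k)"

definition bform :: "nat \<Rightarrow> (nat \<Rightarrow> nat \<Rightarrow> real) \<Rightarrow> (nat \<Rightarrow> real) \<Rightarrow> (nat \<Rightarrow> real) \<Rightarrow> real" where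
  "bform p A x y = (\<Sum>j<p. x j * mapp p A y j)"

lemma bform_add_left: "bform p A (\<lambda>i. x i + y i) z = bform p A x z + bform p A y z"
  by (simp add: bform_def sum.distrib algebra_simps)

lemma bform_scale_left: "bform p A (\<lambda>i. t * x i) z = t * bform p A x z"
  by (simp add: bform_def sum_distrib_left algebra_simps)

lemma mapp_add: "mapp p A (\<lambda>i. x i + y i) j = mapp p A x j + mapp p A y j"
  by (simp add: mapp_def sum.distrib algebra_simps)

lemma mapp_scale: "mapp p A (\<lambda>i. t * x i) j = t * mapp p A x j"
  by (simp add: mapp_def sum_distrib_left algebra_simps)

lemma bform_add_right: "bform p A z (\<lambda>i. x i + y i) = bform p A z x + bform p A z y"
  by (simp add: bform_def mapp_add sum.distrib algebra_simps)

lemma bform_scale_right: "bform p A z (\<lambda>i. t * x i) = t * bform p A z x"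
  by (simp add: bform_def mapp_scale sum_distrib_left algebra_simps)

lemma mapp_diff: "mapp p A (\<lambda>i. x i - y i) j = mapp p A x j - mapp p A y j"
  using mapp_add[of p A x "\<lambda>i. (-1) * y i" j] mapp_scale[of p A "-1" y j] by simp

lemma bform_diff_left: "bform p A (\<lambda>i. x i - y i) z = bform p A x z - bform p A y z"
  using bform_add_left[of p A x "\<lambda>i. (-1) * y i" z] bform_scale_left[of p A "-1" y z] by simp

lemma bform_diff_right: "bform p A z (\<lambda>i. x i - y i) = bform p A z x - bform p A z y"
  using bform_add_right[of p A z x "\<lambda>i. (-1) * y i"] bform_scale_right[of p A z "-1" y] by simp

lemma bform_cong: "(\<And>j. j < p \<Longrightarrow> x j = x' j) \<Longrightarrow> (\<And>j. j < p \<Longrightarrow> y j = y' j) \<Longrightarrow>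
    bform p A x y = bform p A x' y'"
  by (simp add: bform_def mapp_def)

lemma bform_cutoff_left: "N \<subseteq> {..<p} \<Longrightarrow> bform p A (cutoff x N) y = (\<Sum>j\<in>N. x j * mapp p A y j)"
proof -
  assume N: "N \<subseteq> {..<p}"
  have "bform p A (cutoff x N) y = (\<Sum>j<p. if j \<in> N then x j * mapp p A y j else 0)"
    unfolding bform_def cutoff_def by (intro sum.cong) auto
  also have "\<dots> = (\<Sum>j\<in>N. x j * mapp p A y j)"
    using N by (simp add: sum.inter_restrict[symmetric] Int_absorb1)
  finally show ?thesis .
qed

lemma cutoff_add_cutoff: "M \<inter> N = {} \<Longrightarrow> (\<lambda>i. cutoff x M i + cutoff x N i) = cutoff x (M \<union> N)"
  by (auto simp: cutoff_def fun_eq_iff)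

lemma cutoff_idem: "(\<And>j. j \<notin> N \<Longrightarrow> x j = 0) \<Longrightarrow> cutoff x N = x"
  by (auto simp: cutoff_def fun_eq_iff)

lemma L2_set_cutoff: "N \<subseteq> M \<Longrightarrow> finite M \<Longrightarrow> L2_set (cutoff x N) M = L2_set x N"
  unfolding L2_set_def cutoff_def
  by (intro arg_cong[where f=sqrt] sum.mono_neutral_cong_right) auto

lemma L2_set_square: "(L2_set x N)\<^sup>2 = (\<Sum>j\<in>N. (x j)\<^sup>2)"
  by (simp add: L2_set_def sum_nonneg)

lemma L2_set_mono_set: "N \<subseteq> M \<Longrightarrow> finite M \<Longrightarrow> L2_set x N \<le> L2_set x M"
  unfolding L2_set_def by (intro real_sqrt_le_mono sum_mono2) auto

text \<open>First-order condition along a line. Only small \<open>t\<close> are demanded, so that it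
  also applies beside a kink of the absolute value.\<close>

lemma quadratic_nonneg_imp_zero:
  fixes c a e :: real
  assumes "0 < e" "\<And>t. \<bar>t\<bar> \<le> e \<Longrightarrow> 0 \<le> t * c + t\<^sup>2 * a"
  shows "c = 0"
proof (rule ccontr)
  assume "c \<noteq> 0"
  \<comment> \<open>With this \<open>u\<close> the quadratic term is at most half the linear one, so
    t = - sgn c * u makes the sum negative.\<close>
  define u where "u = min e (\<bar>c\<bar> / (2 * (\<bar>a\<bar> + 1)))"
  have u: "0 < u" "u \<le> e" using \<open>c \<noteq> 0\<close> assms(1) by (auto simp: u_def)
  have "u * (2 * (\<bar>a\<bar> + 1)) \<le> \<bar>c\<bar>"
    using mult_right_mono[of u "\<bar>c\<bar> / (2 * (\<bar>a\<bar> + 1))" "2 * (\<bar>a\<bar> + 1)"] by (auto simp: u_def)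
  hence 1: "u * \<bar>a\<bar> < \<bar>c\<bar>" using u(1) mult_nonneg_nonneg[of u "\<bar>a\<bar>"]
    unfolding distrib_left by linarith
  have "0 \<le> (- sgn c * u) * c + (- sgn c * u)\<^sup>2 * a"
    using u by (intro assms(2)) (auto simp: abs_mult sgn_if)
  also have "\<dots> = u * (u * a - \<bar>c\<bar>)" using \<open>c \<noteq> 0\<close>
    by (auto simp: sgn_if power2_eq_square algebra_simps)
  also have "\<dots> \<le> u * (u * \<bar>a\<bar> - \<bar>c\<bar>)" using u(1) by (intro mult_left_mono) auto
  also have "\<dots> < 0" using u(1) 1 by (simp add: mult_pos_neg)
  finally show False by simp
qed

text \<open>First-order condition at the kink: the slope of the smooth part must lie in [-1, 1], the
  subdifferential of the absolute value at 0.\<close>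

lemma quadratic_abs_nonneg_imp_le_one:
  fixes c a :: real
  assumes "\<And>t. 0 \<le> t * c + t\<^sup>2 * a + \<bar>t\<bar>"
  shows "\<bar>c\<bar> \<le> 1"
proof (rule ccontr)
  assume c: "\<not> \<bar>c\<bar> \<le> 1"
  define u where "u = (\<bar>c\<bar> - 1) / (2 * (\<bar>a\<bar> + 1))"
  have u: "0 < u" using c by (auto simp: u_def)
  have "u * (2 * (\<bar>a\<bar> + 1)) = \<bar>c\<bar> - 1" by (auto simp: u_def)
  hence 1: "u * \<bar>a\<bar> < \<bar>c\<bar> - 1" using u mult_nonneg_nonneg[of u "\<bar>a\<bar>"]
    unfolding distrib_left by linarith
  have "0 \<le> (- sgn c * u) * c + (- sgn c * u)\<^sup>2 * a + \<bar>- sgn c * u\<bar>" by (rule assms)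
  also have "\<dots> = u * (u * a - (\<bar>c\<bar> - 1))" using c u
    by (auto simp: sgn_if power2_eq_square algebra_simps abs_mult)
  also have "\<dots> \<le> u * (u * \<bar>a\<bar> - (\<bar>c\<bar> - 1))" using u by (intro mult_left_mono) auto
  also have "\<dots> < 0" using u 1 by (simp add: mult_pos_neg)
  finally show False by simp
qed

lemma bform_sym:
  assumes "\<And>j k. A j k = A k j"
  shows "bform p A x y = bform p A y x"
  unfolding bform_def mapp_def sum_distrib_left
  by (subst sum.swap) (use assms in \<open>simp add: algebra_simps\<close>)

lemma bform_Cauchy_Schwarz:
  assumes sym: "\<And>j k. A j k = A k j" and psd: "\<And>x. 0 \<le> bform p A x x"
  shows "\<bar>bform p A x y\<bar> \<le> sqrt (bform p A x x) * sqrt (bform p A y y)"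
proof -
  define a b c where "a = bform p A x x" and "b = bform p A x y" and "c = bform p A y y"
  have q: "0 \<le> a + 2 * t * b + t\<^sup>2 * c" for t
    using psd[of "\<lambda>i. x i + t * y i"] bform_sym[of A p y x, OF sym]
    unfolding bform_add_left bform_add_right bform_scale_left bform_scale_right a_def b_def c_def
    by (simp add: algebra_simps power2_eq_square)
  have "b\<^sup>2 \<le> a * c"
  proof (cases "c = 0")
    case True
    \<comment> \<open>The quadratic is now affine in \<open>t\<close>, and unless b = 0 this
      \<open>t\<close> gives it the value -1.\<close>
    have "b = 0"
      using q[of "- (a + 1) / (2 * b)"] True by (cases "b = 0") (auto simp: field_simps)
    then show ?thesis using True by simp
  next
    case False
    then have c: "c > 0" using psd[of y] by (simp add: c_def)
    have "0 \<le> c * (a + 2 * (- b / c) * b + (- b / c)\<^sup>2 * c)"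
      using q[of "- b / c"] c by (intro mult_nonneg_nonneg) auto
    also have "\<dots> = a * c - b\<^sup>2" using c by (simp add: field_simps power2_eq_square)
    finally show ?thesis by simp
  qed
  then have "\<bar>b\<bar> \<le> sqrt (a * c)" by (metis real_sqrt_abs real_sqrt_le_mono)
  then show ?thesis by (simp add: real_sqrt_mult a_def b_def c_def)
qed

text \<open>The constants enter only as valid inequalities, so least elements and suprema never
  appear in the analysis. \<open>\<theta>\<close> and \<open>\<theta>'\<close> stand for the
  orthogonality constants with N = s and N = 2s. \<open>orth\<close> speaks of \<open>S\<close>
  alone because S \<subseteq> N and card N \<le> s force N = S.\<close>

locale rip_form =
  fixes p s :: nat and A :: "nat \<Rightarrow> nat \<Rightarrow> real" and S :: "nat set" and \<delta> \<theta> \<theta>' :: real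
  assumes S: "S \<subseteq> {..<p}" "card S = s" "0 < s"
    and sym: "\<And>j k. A j k = A k j"
    and psd: "\<And>x. 0 \<le> bform p A x x"
    and isometry_lower: "\<And>x N. N \<subseteq> {..<p} \<Longrightarrow> card N \<le> s \<Longrightarrow>
      (1 - \<delta>) * (L2_set x N)\<^sup>2 \<le> bform p A (cutoff x N) (cutoff x N)"
    and isometry_upper: "\<And>x N. N \<subseteq> {..<p} \<Longrightarrow> card N \<le> s \<Longrightarrow>
      bform p A (cutoff x N) (cutoff x N) \<le> (1 + \<delta>) * (L2_set x N)\<^sup>2"
    and orth: "\<And>x M. M \<subseteq> {..<p} - S \<Longrightarrow> card M \<le> s \<Longrightarrow>
      \<bar>bform p A (cutoff x S) (cutoff y M)\<bar> \<le> \<theta> * L2_set x S * L2_set y M"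
    and orth': "\<And>x N M. S \<subseteq> N \<Longrightarrow> N \<subseteq> {..<p} \<Longrightarrow> card N \<le> 2 * s \<Longrightarrow> M \<subseteq> {..<p} - N \<Longrightarrow>
      card M \<le> s \<Longrightarrow> \<bar>bform p A (cutoff x N) (cutoff y M)\<bar> \<le> \<theta>' * L2_set x N * L2_set y M"
    and nonneg: "0 \<le> \<theta>" "0 \<le> \<theta>'"
    and rip: "\<delta> + \<theta> + \<theta>' < 1"
begin

abbreviation "F \<equiv> bform p A"
text \<open>Since \<open>A\<close> is symmetric, A x is the gradient of F x x / 2, the smooth part
  of the objective.\<close>

abbreviation "grad \<equiv> mapp p A"

lemmas F_sym = bform_sym[where A = A and p = p, OF sym]
lemmas F_Cauchy_Schwarz = bform_Cauchy_Schwarz[where A = A and p = p, OF sym psd]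

lemma fin: "N \<subseteq> {..<p} \<Longrightarrow> finite N"
  by (rule finite_subset) auto

lemma F_cutoff_Un:
  assumes "M \<inter> N = {}"
  shows "F (cutoff x (M \<union> N)) (cutoff x (M \<union> N))
    = F (cutoff x M) (cutoff x M) + 2 * F (cutoff x M) (cutoff x N) + F (cutoff x N) (cutoff x N)"
  unfolding cutoff_add_cutoff[OF assms, symmetric] bform_add_left bform_add_right
  using F_sym[of "cutoff x M" "cutoff x N"] by simp

section \<open>Lower bounds for the form on sparse supports and on the cone\<close>

lemma F_block_bound:
  assumes "finite T" "0 \<le> C"
    and "\<And>M. M \<subseteq> T \<Longrightarrow> card M \<le> s \<Longrightarrow> \<bar>F u (cutoff x M)\<bar> \<le> C * L2_set x M"
    and "\<And>j. j \<in> T \<Longrightarrow> \<bar>x j\<bar> \<le> B" "0 \<le> B"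
  shows "\<bar>F u (cutoff x T)\<bar> \<le> C * (sqrt s * B + (\<Sum>j\<in>T. \<bar>x j\<bar>) / sqrt s)"
proof (rule subadditive_block_bound[of T s C "\<lambda>M. \<bar>F u (cutoff x M)\<bar>"])
  show "\<bar>F u (cutoff x (M \<union> M'))\<bar> \<le> \<bar>F u (cutoff x M)\<bar> + \<bar>F u (cutoff x M')\<bar>" if "M \<inter> M' = {}" for M M'
    unfolding cutoff_add_cutoff[OF that, symmetric] bform_add_right by (rule abs_triangle_ineq)
qed (use assms S(3) in auto)

text \<open>\<open>S\<close> and \<open>N - S\<close> have at most \<open>s\<close> elements each,
  so the isometry bound holds on both, and the cross term costs 2 \<theta> u v \<le> \<theta> (u^2 +
  v^2). This is also what makes \<open>Sigma11\<close> invertible for the \<open>N\<close> found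
  later.\<close>

lemma isometry_lower_double:
  assumes N: "S \<subseteq> N" "N \<subseteq> {..<p}" "card N \<le> 2 * s"
  shows "(1 - \<delta> - \<theta>) * (L2_set x N)\<^sup>2 \<le> F (cutoff x N) (cutoff x N)"
proof -
  define M where "M = N - S"
  have M: "M \<subseteq> {..<p} - S" "card M \<le> s" "S \<inter> M = {}" "S \<union> M = N"
    using N S card_Diff_subset[of S N] fin[of S] by (auto simp: M_def)
  define u v where "u = L2_set x S" and "v = L2_set x M"
  have "(L2_set x N)\<^sup>2 = u\<^sup>2 + v\<^sup>2"
    using M fin[of S] fin[of M] S(1) unfolding L2_set_square u_def v_def M(4)[symmetric]
    by (subst sum.union_disjoint) auto
  then have "(1 - \<delta> - \<theta>) * (L2_set x N)\<^sup>2
      = (1 - \<delta>) * u\<^sup>2 + (1 - \<delta>) * v\<^sup>2 - \<theta> * (u\<^sup>2 + v\<^sup>2)" by (simp add: algebra_simps)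
  also have "\<dots> \<le> (1 - \<delta>) * u\<^sup>2 + (1 - \<delta>) * v\<^sup>2 - \<theta> * (2 * u * v)"
    using nonneg(1) sum_squares_bound[of u v] by (simp add: mult_left_mono)
  also have "\<dots> \<le> F (cutoff x S) (cutoff x S) + F (cutoff x M) (cutoff x M) + 2 * F (cutoff x S) (cutoff x M)"
  proof -
    have "(1 - \<delta>) * u\<^sup>2 \<le> F (cutoff x S) (cutoff x S)"
      unfolding u_def using S by (intro isometry_lower) auto
    moreover have "(1 - \<delta>) * v\<^sup>2 \<le> F (cutoff x M) (cutoff x M)"
      unfolding v_def using M by (intro isometry_lower) auto
    moreover have "\<bar>F (cutoff x S) (cutoff x M)\<bar> \<le> \<theta> * u * v"
      unfolding u_def v_def using M by (intro orth) auto
    ultimately show ?thesis by (simp add: abs_le_iff)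
  qed
  also have "\<dots> = F (cutoff x N) (cutoff x N)" using F_cutoff_Un[OF M(3), of x] M(4) by simp
  finally show ?thesis .
qed

text \<open>The lower bound for the square of phi(S,2s); multiplied by 1 - \<delta>, the bound for
  the square of Lambda, it gives the square of the claimed product.\<close>

definition \<phi>2 :: real where "\<phi>2 = (1 - \<delta> - \<theta> - \<theta>')\<^sup>2 / (1 - \<delta> - \<theta>)"

lemma \<phi>2_pos: "0 < \<phi>2"
  using rip nonneg by (simp add: \<phi>2_def)

text \<open>The last condition in \<open>B\<close> lets \<open>N - S\<close> act as the predecessor
  of the first tail block. The blocks then add up to the l1-norm off \<open>S\<close> divided by
  sqrt s, which the cone bounds by \<open>L\<close>. So F x_N x \<ge> Y^2 - \<theta>' L^2, and
  Cauchy-Schwarz turns this into a bound for F x x.\<close>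

lemma cone_lower_full:
  assumes N: "S \<subseteq> N" "N \<subseteq> {..<p}" "card N \<le> 2 * s"
    and B: "\<And>j. j \<in> {..<p} - N \<Longrightarrow> \<bar>x j\<bar> \<le> B" "0 \<le> B" "real s * B \<le> (\<Sum>j\<in>N - S. \<bar>x j\<bar>)"
    and cone: "(\<Sum>j\<in>{..<p} - S. \<bar>x j\<bar>) \<le> (\<Sum>j\<in>S. \<bar>x j\<bar>)"
  shows "\<phi>2 * (L2_set x N)\<^sup>2 \<le> F x x"
proof (cases "L2_set x N = 0")
  case True
  then show ?thesis using psd by simp
next
  case False
  define L where "L = L2_set x N"
  have L: "0 < L" using False by (simp add: L_def less_le)
  define a where "a = sqrt (1 - \<delta> - \<theta>)"
  have a: "0 < a" "a\<^sup>2 = 1 - \<delta> - \<theta>" using rip nonneg by (auto simp: a_def)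
  define X Y where "X = sqrt (F x x)" and "Y = sqrt (F (cutoff x N) (cutoff x N))"
  have Y: "a * L \<le> Y"
    unfolding Y_def using isometry_lower_double[OF N, of x] a L
    by (intro real_le_rsqrt) (auto simp: power_mult_distrib L_def)
  have "real s * B / sqrt s = sqrt s * B" using S(3) by (simp add: field_simps)
  then have sB: "sqrt s * B \<le> (\<Sum>j\<in>N - S. \<bar>x j\<bar>) / sqrt s"
    using divide_right_mono[OF B(3), of "sqrt s"] by simp
  have "\<bar>F (cutoff x N) (cutoff x ({..<p} - N))\<bar>
      \<le> \<theta>' * L * (sqrt s * B + (\<Sum>j\<in>{..<p} - N. \<bar>x j\<bar>) / sqrt s)"
    using B N L nonneg(2) by (intro F_block_bound) (auto simp: L_def intro!: orth')
  also have "\<dots> \<le> \<theta>' * L * ((\<Sum>j\<in>N - S. \<bar>x j\<bar>) / sqrt s + (\<Sum>j\<in>{..<p} - N. \<bar>x j\<bar>) / sqrt s)"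
    using sB L nonneg(2) by (intro mult_left_mono) auto
  also have "(\<Sum>j\<in>N - S. \<bar>x j\<bar>) / sqrt s + (\<Sum>j\<in>{..<p} - N. \<bar>x j\<bar>) / sqrt s
      = (\<Sum>j\<in>{..<p} - S. \<bar>x j\<bar>) / sqrt s"
  proof -
    have "{..<p} - S = (N - S) \<union> ({..<p} - N)" using N S by auto
    moreover have "(\<Sum>j\<in>(N - S) \<union> ({..<p} - N). \<bar>x j\<bar>)
        = (\<Sum>j\<in>N - S. \<bar>x j\<bar>) + (\<Sum>j\<in>{..<p} - N. \<bar>x j\<bar>)"
      using fin[OF N(2)] by (intro sum.union_disjoint) auto
    ultimately show ?thesis by (simp add: add_divide_distrib)
  qed
  also have "\<dots> \<le> L"
  proof -
    have "(\<Sum>j\<in>{..<p} - S. \<bar>x j\<bar>) \<le> sqrt s * L2_set x S"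
      using cone sum_abs_le_L2_set[of x S] S by simp
    also have "\<dots> \<le> sqrt s * L"
      unfolding L_def using N fin by (intro mult_left_mono L2_set_mono_set) auto
    finally show ?thesis using S(3) by (simp add: field_simps)
  qed
  finally have cross: "\<bar>F (cutoff x N) (cutoff x ({..<p} - N))\<bar> \<le> \<theta>' * L\<^sup>2"
    using L nonneg(2) by (simp add: mult_left_mono power2_eq_square mult.assoc)
  have "F (cutoff x N) x = F (cutoff x N) (\<lambda>j. cutoff x N j + cutoff x ({..<p} - N) j)"
    by (intro bform_cong) (auto simp: cutoff_def)
  also have "\<dots> = Y\<^sup>2 + F (cutoff x N) (cutoff x ({..<p} - N))"
    unfolding bform_add_right Y_def using psd by simp
  finally have "Y\<^sup>2 - \<theta>' * L\<^sup>2 \<le> F (cutoff x N) x" using cross by simp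
  also have "\<dots> \<le> Y * X" using F_Cauchy_Schwarz[of "cutoff x N" x] by (simp add: X_def Y_def)
  finally have XY: "Y\<^sup>2 - \<theta>' * L\<^sup>2 \<le> Y * X" .
  have aL: "0 < a * L" "0 < Y" using a L Y by (auto intro: less_le_trans[of 0 "a * L"])
  have "(a\<^sup>2 - \<theta>') * L / a = a * L - \<theta>' * L\<^sup>2 / (a * L)"
    using a L by (simp add: field_simps power2_eq_square)
  \<comment> \<open>Y - \<theta>' L^2 / Y increases with \<open>Y\<close>, so the lower bound a L
    may replace \<open>Y\<close>.\<close>
  also have "\<dots> \<le> Y - \<theta>' * L\<^sup>2 / Y"
    using Y aL nonneg(2) by (intro diff_mono divide_left_mono) auto
  also have "\<dots> \<le> X"
    using XY aL by (simp add: field_simps power2_eq_square)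
  finally have "((a\<^sup>2 - \<theta>') * L / a)\<^sup>2 \<le> X\<^sup>2"
    using a L rip by (intro power_mono) (auto intro!: divide_nonneg_pos mult_nonneg_nonneg)
  then show ?thesis
    using psd a by (simp add: X_def \<phi>2_def L_def power_divide power_mult_distrib)
qed

text \<open>Filling \<open>N\<close> up to exactly 2s indices with the largest remaining entries
  leaves \<open>s\<close> indices outside \<open>S\<close> that all dominate the tail, and the
  smallest of their moduli serves as \<open>B\<close>. If p \<le> 2s there is no tail and B = 0
  works. For N = S the hypothesis \<open>top\<close> is vacuous.\<close>

lemma dominating_extension:
  fixes x :: "nat \<Rightarrow> real"
  assumes N: "S \<subseteq> N" "N \<subseteq> {..<p}" "card N \<le> 2 * s"
    and top: "\<And>i j. i \<in> N - S \<Longrightarrow> j \<in> {..<p} - N \<Longrightarrow> \<bar>x j\<bar> \<le> \<bar>x i\<bar>"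
  shows "\<exists>N' B. N \<subseteq> N' \<and> N' \<subseteq> {..<p} \<and> card N' \<le> 2 * s \<and>
    (\<forall>j\<in>{..<p} - N'. \<bar>x j\<bar> \<le> B) \<and> 0 \<le> B \<and> real s * B \<le> (\<Sum>j\<in>N' - S. \<bar>x j\<bar>)"
proof (cases "p \<le> 2 * s")
  case True
  then show ?thesis using N by (intro exI[of _ "{..<p}"] exI[of _ 0]) (auto simp: sum_nonneg)
next
  case False
  have "card ({..<p} - N) = p - card N" using N fin by (simp add: card_Diff_subset)
  then obtain M where M: "M \<subseteq> {..<p} - N" "card M = 2 * s - card N"
      "\<forall>i\<in>M. \<forall>j\<in>{..<p} - N - M. \<bar>x j\<bar> \<le> \<bar>x i\<bar>"
    using exists_largest_subset[of "{..<p} - N" "2 * s - card N" "\<lambda>j. \<bar>x j\<bar>"] False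
      diff_le_mono[of "2 * s" p "card N"] by auto
  define N' where "N' = N \<union> M"
  have fM: "finite M" using M(1) by (rule finite_subset) auto
  have N': "N \<subseteq> N'" "N' \<subseteq> {..<p}" using M(1) N by (auto simp: N'_def)
  have "card N' = 2 * s"
    unfolding N'_def using M N fin[OF N(2)] fM by (subst card_Un_disjoint) auto
  then have cD: "card (N' - S) = s"
    using S N N' fin by (subst card_Diff_subset) auto
  have D: "N' - S \<noteq> {}" "finite (N' - S)"
    using cD S(3) fin[OF N'(2)] by (metis card.empty less_irrefl, simp)
  define B where "B = Min ((\<lambda>j. \<bar>x j\<bar>) ` (N' - S))"
  show ?thesis
  proof (intro exI[of _ N'] exI[of _ B] conjI ballI)
    show "0 \<le> B" unfolding B_def using D by auto
    show "real s * B \<le> (\<Sum>j\<in>N' - S. \<bar>x j\<bar>)"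
      unfolding cD[symmetric] B_def using D by (intro sum_bounded_below Min_le) auto
    fix j assume j: "j \<in> {..<p} - N'"
    have "\<bar>x j\<bar> \<le> \<bar>x i\<bar>" if "i \<in> N' - S" for i
    proof (cases "i \<in> M")
      case True
      then show ?thesis using M(3) j by (simp add: N'_def)
    next
      case False
      then show ?thesis using that j by (intro top) (auto simp: N'_def)
    qed
    then show "\<bar>x j\<bar> \<le> B" unfolding B_def using D by auto
  qed (use N' \<open>card N' = 2 * s\<close> in auto)
qed

text \<open>Passing to the filled-up set only increases the l2-norm on the left.\<close>

lemma cone_lower:
  assumes N: "S \<subseteq> N" "N \<subseteq> {..<p}" "card N \<le> 2 * s"
    and top: "\<And>i j. i \<in> N - S \<Longrightarrow> j \<in> {..<p} - N \<Longrightarrow> \<bar>x j\<bar> \<le> \<bar>x i\<bar>"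
    and cone: "(\<Sum>j\<in>{..<p} - S. \<bar>x j\<bar>) \<le> (\<Sum>j\<in>S. \<bar>x j\<bar>)"
  shows "\<phi>2 * (L2_set x N)\<^sup>2 \<le> F x x"
proof -
  obtain N' B where N': "N \<subseteq> N'" "N' \<subseteq> {..<p}" "card N' \<le> 2 * s"
    "\<And>j. j \<in> {..<p} - N' \<Longrightarrow> \<bar>x j\<bar> \<le> B" "0 \<le> B" "real s * B \<le> (\<Sum>j\<in>N' - S. \<bar>x j\<bar>)"
    using dominating_extension[where N = N and x = x, OF N top] by blast
  have "\<phi>2 * (L2_set x N)\<^sup>2 \<le> \<phi>2 * (L2_set x N')\<^sup>2"
    using N' fin \<phi>2_pos by (intro mult_left_mono power_mono L2_set_mono_set) auto
  also have "\<dots> \<le> F x x" using N(1) N'(1) by (intro cone_lower_full[OF _ N'(2-6) cone]) auto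
  finally show ?thesis .
qed

end

section \<open>Existence and stationarity of the minimiser\<close>

lemma compact_box_fun:
  fixes R :: real
  shows "compact {b :: nat \<Rightarrow> real. \<forall>j. b j \<in> (if j \<in> T then {- R..R} else {0})}"
proof -
  have "compactin (product_topology (\<lambda>_. euclidean) UNIV)
      (PiE UNIV (\<lambda>j. if j \<in> T then {- R..R} else {0}))"
    unfolding compactin_PiE by auto
  moreover have "PiE UNIV (\<lambda>j. if j \<in> T then {- R..R} else {0})
      = {b :: nat \<Rightarrow> real. \<forall>j. b j \<in> (if j \<in> T then {- R..R} else {0})}"
    by (auto simp: PiE_def Pi_def)
  ultimately show ?thesis
    by (simp add: euclidean_product_topology)
qed

lemma continuous_on_coordinate [continuous_intros]:
  "continuous_on K (\<lambda>b :: nat \<Rightarrow> real. b j)"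
  by (rule continuous_on_subset[OF continuous_on_product_coordinates]) auto

text \<open>\<open>h\<close> may depend on the index so that one statement covers both the linear
  penalty with weights \<open>\<tau>\<close> and the absolute values.\<close>

lemma sum_upd_eq:
  fixes h :: "nat \<Rightarrow> real \<Rightarrow> real"
  assumes "finite N" "j \<in> N"
  shows "(\<Sum>i\<in>N. h i (b i + t * (if i = j then 1 else 0))) - (\<Sum>i\<in>N. h i (b i)) = h j (b j + t) - h j (b j)"
proof -
  have "(\<Sum>i\<in>N - {j}. h i (b i + t * (if i = j then 1 else 0))) = (\<Sum>i\<in>N - {j}. h i (b i))"
    by (intro sum.cong) auto
  then show ?thesis
    using sum.remove[OF assms, of "\<lambda>i. h i (b i + t * (if i = j then 1 else 0))"]
      sum.remove[OF assms, of "\<lambda>i. h i (b i)"] by simp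
qed

lemma bform_basis_left: "j < p \<Longrightarrow> bform p A (\<lambda>i. if i = j then 1 else 0) y = mapp p A y j"
  by (simp add: bform_def if_distrib[of "\<lambda>u. u * _"] cong: if_cong)

context rip_form
begin

text \<open>
  The limit of the Lasso objective, in the rescaled estimation error \<open>b\<close>, as the true
  coefficients on \<open>S\<close> tend to infinity with signs \<open>\<tau>\<close>: there the penalty becomes linear.
\<close>

definition objective :: "nat set \<Rightarrow> (nat \<Rightarrow> real) \<Rightarrow> (nat \<Rightarrow> real) \<Rightarrow> real" where
  "objective T \<tau> b = F b b / 2 + (\<Sum>j\<in>S. \<tau> j * b j) + (\<Sum>j\<in>T - S. \<bar>b j\<bar>)"

text \<open>As F b b \<ge> 0, a value at most 0 forces W \<le> V, the cone condition. Hence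
  \<open>\<phi>2\<close> L^2 \<le> F b b \<le> 2 V \<le> 2 sqrt s L, which bounds \<open>L\<close>,
  then \<open>V\<close>, and so every entry.\<close>

lemma objective_sublevel_bounded:
  assumes T: "S \<subseteq> T" "T \<subseteq> {..<p}" and \<tau>: "\<And>j. j \<in> S \<Longrightarrow> \<bar>\<tau> j\<bar> \<le> 1"
    and b: "\<And>j. j \<notin> T \<Longrightarrow> b j = 0" and le: "objective T \<tau> b \<le> 0" and j: "j \<in> T"
  shows "\<bar>b j\<bar> \<le> 2 * s / \<phi>2"
proof -
  define V W L where "V = (\<Sum>j\<in>S. \<bar>b j\<bar>)" and "W = (\<Sum>j\<in>T - S. \<bar>b j\<bar>)" and "L = L2_set b S"
  have "(\<Sum>j\<in>S. - (\<tau> j * b j)) \<le> V" unfolding V_def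
  proof (rule sum_mono)
    fix j assume "j \<in> S"
    have "\<bar>\<tau> j * b j\<bar> \<le> 1 * \<bar>b j\<bar>"
      unfolding abs_mult using \<tau>[OF \<open>j \<in> S\<close>] by (intro mult_right_mono) auto
    then show "- (\<tau> j * b j) \<le> \<bar>b j\<bar>" by simp
  qed
  then have 1: "F b b / 2 + W \<le> V"
    using le by (simp add: objective_def W_def sum_negf)
  then have WV: "W \<le> V" using psd[of b] by simp
  have W': "(\<Sum>j\<in>{..<p} - S. \<bar>b j\<bar>) = W"
    unfolding W_def using T b by (intro sum.mono_neutral_right) auto
  have "\<phi>2 * L\<^sup>2 \<le> F b b"
    unfolding L_def using WV W' S by (intro cone_lower) (auto simp: V_def)
  moreover have "0 \<le> W" by (simp add: W_def sum_nonneg)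
  ultimately have "\<phi>2 * L\<^sup>2 \<le> 2 * V" using 1 by simp
  also have Vs: "V \<le> sqrt s * L" using sum_abs_le_L2_set[of b S] S by (simp add: V_def L_def)
  finally have "L * (\<phi>2 * L) \<le> L * (2 * sqrt s)" by (simp add: power2_eq_square algebra_simps)
  moreover have "0 \<le> L" by (simp add: L_def L2_set_nonneg)
  ultimately have "\<phi>2 * L \<le> 2 * sqrt s" by (cases "L = 0") auto
  then have "sqrt s * (\<phi>2 * L) \<le> sqrt s * (2 * sqrt s)" by (intro mult_left_mono) auto
  moreover have "sqrt s * (2 * sqrt s) = 2 * s" by simp
  ultimately have "\<phi>2 * (sqrt s * L) \<le> 2 * s" by (simp only: mult.left_commute)
  then have "\<phi>2 * V \<le> 2 * s" using mult_left_mono[OF Vs, of \<phi>2] \<phi>2_pos by linarith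
  then have "V \<le> 2 * s / \<phi>2"
    using \<phi>2_pos by (simp add: pos_le_divide_eq mult.commute)
  moreover have "\<bar>b j\<bar> \<le> V \<or> \<bar>b j\<bar> \<le> W"
  proof (cases "j \<in> S")
    case True
    then show ?thesis unfolding V_def using fin[OF S(1)] member_le_sum[of j S "\<lambda>j. \<bar>b j\<bar>"] by auto
  next
    case False
    then show ?thesis unfolding W_def
      using fin[OF T(2)] j member_le_sum[of j "T - S" "\<lambda>j. \<bar>b j\<bar>"] by auto
  qed
  ultimately show ?thesis using WV by linarith
qed

text \<open>A box containing the sublevel set of 0 is compact; vectors outside that sublevel set
  lose against the origin, where the objective is 0.\<close>

lemma objective_minimiser:
  assumes T: "S \<subseteq> T" "T \<subseteq> {..<p}" and \<tau>: "\<And>j. j \<in> S \<Longrightarrow> \<bar>\<tau> j\<bar> \<le> 1"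
  shows "\<exists>b. (\<forall>j. j \<notin> T \<longrightarrow> b j = 0) \<and>
    (\<forall>x. (\<forall>j. j \<notin> T \<longrightarrow> x j = 0) \<longrightarrow> objective T \<tau> b \<le> objective T \<tau> x)"
proof -
  define R where "R = 2 * s / \<phi>2"
  define K where "K = {b :: nat \<Rightarrow> real. \<forall>j. b j \<in> (if j \<in> T then {- R..R} else {0})}"
  have R: "0 \<le> R" using \<phi>2_pos by (simp add: R_def)
  have "compact K" unfolding K_def by (rule compact_box_fun)
  moreover have K0: "(\<lambda>_. 0) \<in> K" using R by (auto simp: K_def)
  moreover have "continuous_on K (objective T \<tau>)"
    unfolding objective_def bform_def mapp_def by (intro continuous_intros) auto
  ultimately obtain b where b: "b \<in> K" "\<And>x. x \<in> K \<Longrightarrow> objective T \<tau> b \<le> objective T \<tau> x"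
    using continuous_attains_inf[of K "objective T \<tau>"] by blast
  have "objective T \<tau> b \<le> objective T \<tau> x" if x: "\<And>j. j \<notin> T \<Longrightarrow> x j = 0" for x
  proof (cases "objective T \<tau> x \<le> 0")
    case True
    then have "\<bar>x j\<bar> \<le> R" if "j \<in> T" for j
      unfolding R_def using objective_sublevel_bounded[where b = x and \<tau> = \<tau>, OF T \<tau> x] that by auto
    then have "x \<in> K" using x unfolding K_def by (auto simp: abs_le_iff) (smt (verit))+
    then show ?thesis by (rule b)
  next
    case False
    have "objective T \<tau> (\<lambda>_. 0) = 0" by (simp add: objective_def bform_def)
    then show ?thesis using b(2)[OF K0] False by simp
  qed
  moreover have "\<forall>j. j \<notin> T \<longrightarrow> b j = 0"
  proof (intro allI impI)
    fix j assume "j \<notin> T"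
    moreover have "b j \<in> (if j \<in> T then {- R..R} else {0})" using b(1) unfolding K_def by blast
    ultimately show "b j = 0" by simp
  qed
  ultimately show ?thesis by blast
qed

text \<open>Needed for two choices of \<open>T\<close>: all indices give the minimiser itself, and T
  = S, where no absolute values remain, gives its comparison vector.\<close>

lemma objective_KKT:
  assumes T: "S \<subseteq> T" "T \<subseteq> {..<p}" and \<tau>: "\<And>j. j \<in> S \<Longrightarrow> \<bar>\<tau> j\<bar> \<le> 1"
  shows "\<exists>b. (\<forall>j. j \<notin> T \<longrightarrow> b j = 0) \<and> (\<forall>j\<in>S. grad b j = - \<tau> j) \<and>
    (\<forall>j\<in>T - S. \<bar>grad b j\<bar> \<le> 1 \<and> (b j \<noteq> 0 \<longrightarrow> grad b j = - sgn (b j)))"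
proof -
  obtain b where b: "\<And>j. j \<notin> T \<Longrightarrow> b j = 0"
    and min: "\<And>x. (\<And>j. j \<notin> T \<Longrightarrow> x j = 0) \<Longrightarrow> objective T \<tau> b \<le> objective T \<tau> x"
    using objective_minimiser[of T \<tau>] assms by blast
  have finT: "finite T" "finite S" using fin T S by auto
  define e :: "nat \<Rightarrow> nat \<Rightarrow> real" where "e j i = (if i = j then 1 else 0)" for j i
  define x where "x j t = (\<lambda>i. b i + t * e j i)" for j t
  have quad: "F (x j t) (x j t) = F b b + 2 * t * grad b j + t\<^sup>2 * F (e j) (e j)" if "j < p" for j t
  proof -
    have "F (e j) b = grad b j" unfolding e_def using that by (rule bform_basis_left)
    then show ?thesis
      unfolding x_def bform_add_left bform_add_right bform_scale_left bform_scale_right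
      using F_sym[of b "e j"] by (simp add: algebra_simps power2_eq_square)
  qed
  have min': "0 \<le> objective T \<tau> (x j t) - objective T \<tau> b" if "j \<in> T" for j t
  proof -
    have "objective T \<tau> b \<le> objective T \<tau> (x j t)"
      by (rule min) (use b that in \<open>auto simp: x_def e_def\<close>)
    then show ?thesis by simp
  qed
  have S_part: "objective T \<tau> (x j t) - objective T \<tau> b
      = t * (grad b j + \<tau> j) + t\<^sup>2 * (F (e j) (e j) / 2)" if "j \<in> S" for j t
  proof -
    have "(\<Sum>i\<in>T - S. \<bar>x j t i\<bar>) = (\<Sum>i\<in>T - S. \<bar>b i\<bar>)"
      using that by (intro sum.cong) (auto simp: x_def e_def)
    moreover have "(\<Sum>i\<in>S. \<tau> i * x j t i) - (\<Sum>i\<in>S. \<tau> i * b i) = \<tau> j * (b j + t) - \<tau> j * b j"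
      unfolding x_def e_def by (rule sum_upd_eq[OF finT(2) that])
    ultimately show ?thesis
      using quad[of j t] that S by (auto simp: objective_def algebra_simps)
  qed
  have T_part: "objective T \<tau> (x j t) - objective T \<tau> b
      = t * grad b j + t\<^sup>2 * (F (e j) (e j) / 2) + (\<bar>b j + t\<bar> - \<bar>b j\<bar>)" if "j \<in> T - S" for j t
  proof -
    have "(\<Sum>i\<in>S. \<tau> i * x j t i) = (\<Sum>i\<in>S. \<tau> i * b i)"
      using that by (intro sum.cong) (auto simp: x_def e_def)
    moreover have "(\<Sum>i\<in>T - S. \<bar>x j t i\<bar>) - (\<Sum>i\<in>T - S. \<bar>b i\<bar>) = \<bar>b j + t\<bar> - \<bar>b j\<bar>"
      unfolding x_def e_def by (rule sum_upd_eq[of _ _ "\<lambda>_ u. \<bar>u\<bar>"]) (use finT that in auto)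
    ultimately show ?thesis
      using quad[of j t] that T by (auto simp: objective_def algebra_simps add_divide_distrib subset_iff)
  qed
  have "grad b j = - \<tau> j" if "j \<in> S" for j
  proof -
    have "grad b j + \<tau> j = 0"
      using min'[of j] S_part[OF that] that T
      by (intro quadratic_nonneg_imp_zero[of 1 _ "F (e j) (e j) / 2"]) auto
    then show ?thesis by simp
  qed
  moreover have "\<bar>grad b j\<bar> \<le> 1" if "j \<in> T - S" for j
  proof (rule quadratic_abs_nonneg_imp_le_one)
    fix t
    have "0 \<le> t * grad b j + t\<^sup>2 * (F (e j) (e j) / 2) + (\<bar>b j + t\<bar> - \<bar>b j\<bar>)"
      using min'[of j t] T_part[OF that] that by auto
    \<comment> \<open>The triangle inequality reduces every coordinate to the kink, whether or not b
      j = 0.\<close>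
    then show "0 \<le> t * grad b j + t\<^sup>2 * (F (e j) (e j) / 2) + \<bar>t\<bar>" by linarith
  qed
  moreover have "grad b j = - sgn (b j)" if "j \<in> T - S" "b j \<noteq> 0" for j
  proof -
    have "grad b j + sgn (b j) = 0"
    proof (rule quadratic_nonneg_imp_zero[of "\<bar>b j\<bar>" _ "F (e j) (e j) / 2"])
      \<comment> \<open>Within this range b j + t does not change sign, so the absolute value is
        linear there.\<close>
      fix t assume t: "\<bar>t\<bar> \<le> \<bar>b j\<bar>"
      have "0 \<le> t * grad b j + t\<^sup>2 * (F (e j) (e j) / 2) + (\<bar>b j + t\<bar> - \<bar>b j\<bar>)"
        using min'[of j t] T_part[OF that(1)] that by auto
      moreover have "\<bar>b j + t\<bar> - \<bar>b j\<bar> = t * sgn (b j)"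
        using t that(2) by (auto simp: sgn_if)
      ultimately show "0 \<le> t * (grad b j + sgn (b j)) + t\<^sup>2 * (F (e j) (e j) / 2)"
        by (simp add: algebra_simps)
    qed (use that in auto)
    then show ?thesis by simp
  qed
  ultimately show ?thesis using b by blast
qed

end

section \<open>Bounding the number of active coordinates\<close>

lemma sqrt2_less: "sqrt 2 < 1.41422"
  by (rule real_less_lsqrt) (auto simp: power2_eq_square)

context rip_form
begin

text \<open>1 - \<delta> is at least 2 - sqrt 2 > 0.5857, and (1/16) / 0.5857 is just below
  0.107.\<close>

lemma rip_small_constants:
  assumes "\<delta> \<le> sqrt 2 - 1" "\<theta> \<le> 1 / 16" "\<theta>' \<le> 1 / 16"
  shows "0.39 \<le> \<phi>2" "\<theta> / (1 - \<delta>) \<le> 0.107" "1 + \<delta> \<le> 1.4143" "0.58 \<le> 1 - \<delta>"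
proof -
  show \<delta>: "1 + \<delta> \<le> 1.4143" "0.58 \<le> 1 - \<delta>" using assms sqrt2_less by auto
  have "0.107 * 0.5857 \<le> 0.107 * (1 - \<delta>)" using assms sqrt2_less by (intro mult_left_mono) auto
  then show "\<theta> / (1 - \<delta>) \<le> 0.107"
    using assms \<delta> by (simp add: divide_le_eq)
  define u where "u = 1 - \<delta> - \<theta>"
  have u: "0.52 \<le> u" using assms sqrt2_less by (simp add: u_def)
  \<comment> \<open>Expanding the square gives \<open>\<phi>2\<close> = u - 2 \<theta>' +
    \<theta>'^2 / u; the last term is dropped, and 0.5857 - 3/16 exceeds 0.39.\<close>
  have "0.39 \<le> u - 2 * \<theta>'" using assms sqrt2_less by (simp add: u_def)
  also have "\<dots> \<le> u - 2 * \<theta>' + \<theta>'\<^sup>2 / u" using u by simp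
  also have "\<dots> = \<phi>2" unfolding \<phi>2_def u_def[symmetric] using u
    by (simp add: field_simps power2_eq_square)
  finally show "0.39 \<le> \<phi>2" .
qed

lemma isometry_lower_supported:
  assumes N: "N \<subseteq> {..<p}" "card N \<le> s" and x: "\<And>j. j \<notin> N \<Longrightarrow> x j = 0"
  shows "(1 - \<delta>) * (L2_set x N)\<^sup>2 \<le> F x x"
  using isometry_lower[OF N, of x] cutoff_idem[of N x, OF x] by simp

lemma signed_sum_le:
  fixes x \<tau> :: "nat \<Rightarrow> real"
  assumes "\<And>j. j \<in> S \<Longrightarrow> \<bar>\<tau> j\<bar> \<le> 1"
  shows "(\<Sum>j\<in>S. x j * - \<tau> j) \<le> (\<Sum>j\<in>S. \<bar>x j\<bar>)"
proof (rule sum_mono)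
  fix j assume "j \<in> S"
  have "\<bar>x j * - \<tau> j\<bar> \<le> \<bar>x j\<bar> * 1"
    unfolding abs_mult using assms[OF \<open>j \<in> S\<close>] by (intro mult_left_mono) auto
  then show "x j * - \<tau> j \<le> \<bar>x j\<bar>" by simp
qed

text \<open>
  Splitting off the projection \<open>c\<close> of the minimiser onto the span of \<open>S\<close> leaves a residual
  controlled by \<open>\<theta>\<close>; each active coordinate outside \<open>S\<close> contributes \<open>1\<close> to \<open>F v b\<close> below, and
  \<open>s\<close> of them would be too many.
\<close>

lemma few_active_coordinates:
  assumes small: "\<delta> \<le> sqrt 2 - 1" "\<theta> \<le> 1 / 16" "\<theta>' \<le> 1 / 16"
    and \<tau>: "\<And>j. j \<in> S \<Longrightarrow> \<bar>\<tau> j\<bar> \<le> 1"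
    and b: "\<And>j. j \<in> S \<Longrightarrow> grad b j = - \<tau> j"
      "\<And>j. j \<in> {..<p} - S \<Longrightarrow> b j \<noteq> 0 \<Longrightarrow> grad b j = - sgn (b j)"
    and M: "M \<subseteq> {..<p} - S" "card M = s" "\<And>j. j \<in> M \<Longrightarrow> b j \<noteq> 0"
  shows False
proof -
  define P where "P = {..<p} - S"
  \<comment> \<open>\<open>N\<close> joins to \<open>S\<close> the largest other coordinates of
    \<open>b\<close>, so that the tail blocks of \<open>b\<close> can be estimated below.\<close>
  obtain N B where N: "S \<subseteq> N" "N \<subseteq> {..<p}" "card N \<le> 2 * s"
    "\<And>j. j \<in> {..<p} - N \<Longrightarrow> \<bar>b j\<bar> \<le> B" "0 \<le> B" "real s * B \<le> (\<Sum>j\<in>N - S. \<bar>b j\<bar>)"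
  proof -
    have "card S \<le> 2 * s" using S by simp
    then show ?thesis
      using dominating_extension[of S b] S(1) that by (metis Diff_cancel empty_iff order_refl)
  qed
  have finN: "finite N" "finite S" using fin N S by auto
  \<comment> \<open>Both gradients equal - \<tau> on \<open>S\<close>, so b - c is orthogonal to all
    vectors supported on \<open>S\<close>: \<open>c\<close> is the projection of \<open>b\<close>
    onto them.\<close>
  have "\<exists>c. (\<forall>j. j \<notin> S \<longrightarrow> c j = 0) \<and> (\<forall>j\<in>S. grad c j = - \<tau> j)"
    using objective_KKT[of S \<tau>] S(1) \<tau> by auto
  then obtain c where "(\<forall>j. j \<notin> S \<longrightarrow> c j = 0) \<and> (\<forall>j\<in>S. grad c j = - \<tau> j)" ..
  then have c: "\<And>j. j \<notin> S \<Longrightarrow> c j = 0" "\<And>j. j \<in> S \<Longrightarrow> grad c j = - \<tau> j" by auto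
  have cS: "cutoff c S = c" using c(1) by (rule cutoff_idem)
  define V W L X n q where "V = (\<Sum>j\<in>S. \<bar>b j\<bar>)" and "W = (\<Sum>j\<in>P. \<bar>b j\<bar>)"
    and "L = L2_set b N" and "X = L2_set b (N - S)" and "n = L2_set c S" and "q = \<theta> / (1 - \<delta>)"
  note const = rip_small_constants[OF small]
  have q: "q \<le> 0.107" using const(2) by (simp add: q_def)
  have nn: "0 \<le> W" "0 \<le> L" "0 \<le> X" "0 \<le> n" "0 \<le> q" "0 < sqrt s"
    using nonneg const S(3) by (auto simp: W_def L_def X_def n_def q_def sum_nonneg L2_set_nonneg)
  have XL: "X \<le> L" unfolding X_def L_def using finN by (intro L2_set_mono_set) auto
  have VL: "V \<le> sqrt s * L"
  proof -
    have "V \<le> sqrt s * L2_set b S" using sum_abs_le_L2_set[of b S] S by (simp add: V_def)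
    also have "\<dots> \<le> sqrt s * L"
      unfolding L_def using N finN by (intro mult_left_mono L2_set_mono_set) auto
    finally show ?thesis .
  qed
  have Fcut: "F b y = F (cutoff b S) y + F (cutoff b P) y" for y
    unfolding bform_add_left[symmetric] using S by (intro bform_cong) (auto simp: cutoff_def P_def)
  have PW: "F (cutoff b P) b = - W"
  proof -
    have "F (cutoff b P) b = (\<Sum>j\<in>P. b j * grad b j)"
      by (intro bform_cutoff_left) (auto simp: P_def)
    also have "\<dots> = (\<Sum>j\<in>P. - \<bar>b j\<bar>)"
    proof (rule sum.cong)
      fix j assume "j \<in> P"
      then show "b j * grad b j = - \<bar>b j\<bar>"
        using b(2)[of j] by (cases "b j = 0") (auto simp: P_def sgn_if)
    qed simp
    finally show ?thesis by (simp add: W_def sum_negf)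
  qed
  \<comment> \<open>Testing stationarity with \<open>b\<close> itself yields the cone condition and,
    compared with the bound from the sublevel set, saves a factor 2: \<open>\<phi>2\<close> L \<le>
    sqrt s.\<close>
  have "F b b + W = (\<Sum>j\<in>S. b j * - \<tau> j)"
    unfolding Fcut PW using S b(1) by (simp add: bform_cutoff_left)
  also have "\<dots> \<le> V" unfolding V_def using \<tau> by (rule signed_sum_le)
  finally have FV: "F b b + W \<le> V" .
  then have WV: "W \<le> V" using psd[of b] by simp
  have "\<phi>2 * L\<^sup>2 \<le> F b b"
    unfolding L_def using WV by (intro cone_lower_full[OF N]) (auto simp: W_def V_def P_def)
  also have "\<dots> \<le> sqrt s * L" using FV VL nn by simp
  finally have "L * (\<phi>2 * L) \<le> L * sqrt s" by (simp add: power2_eq_square algebra_simps)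
  then have "\<phi>2 * L \<le> sqrt s" using nn by (cases "L = 0") auto
  then have Lb: "L \<le> sqrt s / \<phi>2" using \<phi>2_pos by (simp add: pos_le_divide_eq mult.commute)

  \<comment> \<open>The same test applied to \<open>c\<close>, with the isometry bound in place of
    the cone bound.\<close>
  have "(1 - \<delta>) * n\<^sup>2 \<le> F c c"
    unfolding n_def using c S by (intro isometry_lower_supported) auto
  also have "F c c = (\<Sum>j\<in>S. c j * - \<tau> j)"
    using bform_cutoff_left[OF S(1), of A c c] c(2) cS by simp
  also have "\<dots> \<le> (\<Sum>j\<in>S. \<bar>c j\<bar>)" using \<tau> by (rule signed_sum_le)
  also have "\<dots> \<le> sqrt s * n" using sum_abs_le_L2_set[of c S] S by (simp add: n_def)
  finally have "n * ((1 - \<delta>) * n) \<le> n * sqrt s" by (simp add: power2_eq_square algebra_simps)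
  then have "(1 - \<delta>) * n \<le> sqrt s" using nn by (cases "n = 0") auto
  then have "n \<le> sqrt s / (1 - \<delta>)" using const by (simp add: pos_le_divide_eq mult.commute)
  then have "\<theta> * n \<le> \<theta> * (sqrt s / (1 - \<delta>))" using nonneg by (intro mult_left_mono) auto
  then have \<theta>n: "\<theta> * n \<le> q * sqrt s" by (simp add: q_def)

  define d where "d = (\<lambda>i. b i - c i)"
  have gd: "grad d j = 0" if "j \<in> S" for j
    unfolding d_def mapp_diff using b(1) c(2) that by simp
  have Sd: "F (cutoff x S) d = 0" for x using S gd by (simp add: bform_cutoff_left)
  \<comment> \<open>Orthogonality to \<open>S\<close> removes F c d and the part of \<open>b\<close>
    on \<open>S\<close>; what is left of \<open>b\<close> sees its own gradient, giving - W, and its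
    coupling with \<open>c\<close>.\<close>
  have "F d d = F b d - F c d" unfolding d_def bform_diff_left by simp
  also have "F c d = 0" using Sd[of c] cS by simp
  also have "F b d - 0 = F (cutoff b P) b - F (cutoff b P) c"
    using Fcut[of d] Sd[of b] unfolding d_def bform_diff_right by simp
  also have "\<dots> = - W - F c (cutoff b P)" using PW F_sym[of "cutoff b P" c] by simp
  finally have Fdd: "F d d \<le> \<bar>F c (cutoff b P)\<bar> - W" by linarith

  have orth_c: "\<bar>F c (cutoff y M)\<bar> \<le> \<theta> * n * L2_set y M" if "M \<subseteq> {..<p} - S" "card M \<le> s" for y M
    using orth[OF that, of c y] cS by (simp add: n_def)
  have "real s * B / sqrt s = sqrt s * B" using S(3) by (simp add: field_simps)
  then have sB: "sqrt s * B \<le> (\<Sum>j\<in>N - S. \<bar>b j\<bar>) / sqrt s"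
    using divide_right_mono[OF N(6), of "sqrt s"] by simp
  have PU: "P = (N - S) \<union> ({..<p} - N)" using N by (auto simp: P_def)
  have WU: "W = (\<Sum>j\<in>N - S. \<bar>b j\<bar>) + (\<Sum>j\<in>{..<p} - N. \<bar>b j\<bar>)"
    unfolding W_def PU using finN by (intro sum.union_disjoint) auto
  \<comment> \<open>\<open>N - S\<close> is a single block and is kept apart, since its norm
    \<open>X\<close> is at most \<open>L\<close>; the blocks after it cost at most W / sqrt s in
    total.\<close>
  have "F c (cutoff b P) = F c (cutoff b (N - S)) + F c (cutoff b ({..<p} - N))"
  proof -
    have "cutoff b P = (\<lambda>i. cutoff b (N - S) i + cutoff b ({..<p} - N) i)"
      unfolding PU by (rule cutoff_add_cutoff[symmetric]) auto
    then show ?thesis by (simp only: bform_add_right)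
  qed
  moreover have "\<bar>F c (cutoff b (N - S))\<bar> \<le> \<theta> * n * X"
    unfolding X_def using N S finN by (intro orth_c) (auto simp: card_Diff_subset)
  moreover have "\<bar>F c (cutoff b ({..<p} - N))\<bar>
      \<le> \<theta> * n * (sqrt s * B + (\<Sum>j\<in>{..<p} - N. \<bar>b j\<bar>) / sqrt s)"
    using N nn nonneg by (intro F_block_bound orth_c) auto
  moreover have "\<theta> * n * (sqrt s * B + (\<Sum>j\<in>{..<p} - N. \<bar>b j\<bar>) / sqrt s) \<le> \<theta> * n * (W / sqrt s)"
    unfolding WU add_divide_distrib using sB nn nonneg by (intro mult_left_mono add_right_mono) auto
  ultimately have "\<bar>F c (cutoff b P)\<bar> \<le> \<theta> * n * (X + W / sqrt s)"
    by (simp add: distrib_left)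
  also have "\<dots> \<le> q * sqrt s * (X + W / sqrt s)"
    using \<theta>n nn by (intro mult_right_mono) auto
  also have "\<dots> = q * sqrt s * X + q * W" using nn by (simp add: field_simps)
  \<comment> \<open>As q \<le> 1, this term is swallowed by the - W in \<open>Fdd\<close>; only the
    term with \<open>X\<close> survives.\<close>
  also have "q * W \<le> 1 * W" using q nn by (intro mult_right_mono) auto
  finally have "F d d \<le> q * sqrt s * X" using Fdd by simp
  also have "\<dots> \<le> q * sqrt s * (sqrt s / \<phi>2)"
    using XL Lb nn by (intro mult_left_mono) auto
  finally have Fdd': "F d d \<le> q * s / \<phi>2" by (simp add: mult.assoc)

  \<comment> \<open>A test vector that picks up 1 from each active coordinate in \<open>M\<close>,
    hence F v b = s.\<close>
  define v where "v = cutoff (\<lambda>j. - sgn (b j)) M"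
  have finM: "finite M" using M(1) by (rule finite_subset) auto
  have sgn2: "(sgn (b j))\<^sup>2 = 1" if "j \<in> M" for j using M(3)[OF that] by (auto simp: sgn_if)
  have L2v: "L2_set (\<lambda>j. - sgn (b j)) M = sqrt s"
    unfolding L2_set_def using sgn2 M(2) by simp
  have "F v b = (\<Sum>j\<in>M. - sgn (b j) * grad b j)"
    unfolding v_def using M by (intro bform_cutoff_left) auto
  also have "\<dots> = (\<Sum>j\<in>M. 1)"
  proof (rule sum.cong)
    fix j assume j: "j \<in> M"
    then have "grad b j = - sgn (b j)" using M by (intro b(2)) auto
    then show "- sgn (b j) * grad b j = 1" using sgn2[OF j] by (simp add: power2_eq_square)
  qed simp
  finally have "s = F v b" using M(2) by simp
  also have "F v b = F c v + F v d"
    unfolding d_def bform_diff_right using F_sym[of c v] by simp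
  also have "F c v \<le> q * s"
  proof -
    have "F c v \<le> \<theta> * n * sqrt s" using orth_c[of M "\<lambda>j. - sgn (b j)"] M L2v by (simp add: v_def)
    also have "\<dots> \<le> q * sqrt s * sqrt s" using \<theta>n nn by (intro mult_right_mono) auto
    finally show ?thesis by (simp add: mult.assoc)
  qed
  \<comment> \<open>1.4143 * 0.107 / 0.39 is about 0.39, well below 0.8^2 = 0.64, and 0.107 + 0.8 <
    1 leaves the contradiction.\<close>
  also have "F v d \<le> s * 0.8"
  proof -
    have "F v v \<le> (1 + \<delta>) * s"
      using isometry_upper[of M "\<lambda>j. - sgn (b j)"] M L2v by (auto simp: v_def)
    also have "\<dots> \<le> 1.4143 * s" using const by (intro mult_right_mono) auto
    finally have Fvv: "F v v \<le> 1.4143 * s" .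
    note Fdd'
    also have "q * s / \<phi>2 \<le> 0.107 * s / 0.39"
      using const(1) q nn by (intro frac_le mult_right_mono) auto
    finally have "F v v * F d d \<le> 1.4143 * s * (0.107 * s / 0.39)"
      using Fvv psd by (intro mult_mono) auto
    also have "\<dots> \<le> (real s * 0.8)\<^sup>2" by (simp add: power2_eq_square)
    finally have "F v v * F d d \<le> (real s * 0.8)\<^sup>2" .
    then have "sqrt (F v v) * sqrt (F d d) \<le> s * 0.8"
      unfolding real_sqrt_mult[symmetric] by (intro real_le_lsqrt) auto
    then show ?thesis using F_Cauchy_Schwarz[of v d] by linarith
  qed
  finally have "real s \<le> (q + 0.8) * s" by (simp add: algebra_simps)
  moreover have "(q + 0.8) * s < 1 * real s"
    using q S(3) by (intro mult_strict_right_mono) auto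
  ultimately show False by simp
qed

text \<open>\<open>N\<close> is \<open>S\<close> together with the active coordinates; were there
  more than \<open>s\<close> of these, any \<open>s\<close> of them would contradict
  \<open>few_active_coordinates\<close>.\<close>

lemma weak_irrepresentable_signs:
  assumes small: "\<delta> \<le> sqrt 2 - 1" "\<theta> \<le> 1 / 16" "\<theta>' \<le> 1 / 16"
    and \<tau>: "\<And>j. j \<in> S \<Longrightarrow> \<bar>\<tau> j\<bar> \<le> 1"
  shows "\<exists>N b. S \<subseteq> N \<and> N \<subseteq> {..<p} \<and> card N \<le> 2 * s \<and> (\<forall>j. j \<notin> N \<longrightarrow> b j = 0) \<and>
    (\<forall>j\<in>S. grad b j = - \<tau> j) \<and> (\<forall>j\<in>N - S. b j \<noteq> 0 \<and> grad b j = - sgn (b j)) \<and>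
    (\<forall>j\<in>{..<p} - N. \<bar>grad b j\<bar> \<le> 1)"
proof -
  obtain b where b: "\<And>j. j \<notin> {..<p} \<Longrightarrow> b j = 0" "\<And>j. j \<in> S \<Longrightarrow> grad b j = - \<tau> j"
    "\<And>j. j \<in> {..<p} - S \<Longrightarrow> \<bar>grad b j\<bar> \<le> 1"
    "\<And>j. j \<in> {..<p} - S \<Longrightarrow> b j \<noteq> 0 \<Longrightarrow> grad b j = - sgn (b j)"
    using objective_KKT[of "{..<p}" \<tau>] S \<tau> by blast
  define M where "M = {j \<in> {..<p} - S. b j \<noteq> 0}"
  have finM: "finite M" by (simp add: M_def)
  have "card M \<le> s"
  proof (rule ccontr)
    assume "\<not> card M \<le> s"
    then obtain M' where M': "M' \<subseteq> M" "card M' = s"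
      using obtain_subset_with_card_n[of s M] by auto
    have "M' \<subseteq> {..<p} - S" "\<And>j. j \<in> M' \<Longrightarrow> b j \<noteq> 0" using M'(1) by (auto simp: M_def)
    then show False using few_active_coordinates[OF small \<tau> b(2,4)] M'(2) by blast
  qed
  moreover have "card (S \<union> M) \<le> card S + card M" by (rule card_Un_le)
  ultimately have "card (S \<union> M) \<le> 2 * s" using S by simp
  then show ?thesis
    using b S by (intro exI[of _ "S \<union> M"] exI[of _ b]) (auto simp: M_def)
qed

end

text \<open>A crude constant is enough: it only serves to show that some isometry constant exists
  and that the orthogonality quotients are bounded.\<close>

lemma bform_bounded:
  "\<bar>bform p A x y\<bar> \<le> (\<Sum>j<p. \<Sum>k<p. \<bar>A j k\<bar>) * L2_set x {..<p} * L2_set y {..<p}"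
proof -
  have "\<bar>x j * (A j k * y k)\<bar> \<le> \<bar>A j k\<bar> * (L2_set x {..<p} * L2_set y {..<p})"
    if "j < p" "k < p" for j k
  proof -
    have "\<bar>x j\<bar> * \<bar>y k\<bar> \<le> L2_set x {..<p} * L2_set y {..<p}"
      using member_le_L2_set[of "{..<p}" j "\<lambda>j. \<bar>x j\<bar>"] member_le_L2_set[of "{..<p}" k "\<lambda>j. \<bar>y j\<bar>"] that
      by (intro mult_mono) (auto simp: L2_set_def sum_nonneg)
    then show ?thesis
      using mult_left_mono[of "\<bar>x j\<bar> * \<bar>y k\<bar>" "L2_set x {..<p} * L2_set y {..<p}" "\<bar>A j k\<bar>"]
      by (simp add: abs_mult mult_ac)
  qed
  then have "(\<Sum>j<p. \<Sum>k<p. \<bar>x j * (A j k * y k)\<bar>)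
      \<le> (\<Sum>j<p. \<Sum>k<p. \<bar>A j k\<bar> * (L2_set x {..<p} * L2_set y {..<p}))"
    by (intro sum_mono) auto
  moreover have "\<bar>bform p A x y\<bar> \<le> (\<Sum>j<p. \<Sum>k<p. \<bar>x j * (A j k * y k)\<bar>)"
    unfolding bform_def mapp_def sum_distrib_left
    by (intro order_trans[OF sum_abs] sum_mono) auto
  ultimately show ?thesis by (simp add: sum_distrib_right mult.assoc)
qed

section \<open>Symmetric matrices have a real eigenvalue\<close>

text \<open>Without this, the \<open>Min\<close> in \<open>Lambda\<close> could be taken over the
  empty set. A complex eigenvalue exists, and it is real because the Hermitian form at its
  eigenvector is.\<close>

lemma symmetric_real_spectrum_nonempty:
  fixes A :: "real mat"
  assumes A: "A \<in> carrier_mat n n" and n: "0 < n"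
    and sym: "\<And>i j. i < n \<Longrightarrow> j < n \<Longrightarrow> A $$ (i, j) = A $$ (j, i)"
  shows "spectrum A \<noteq> {}"
proof -
  define C where "C = map_mat complex_of_real A"
  have C: "C \<in> carrier_mat n n" using A by (simp add: C_def)
  obtain l where l: "eigenvalue C l"
    using spectrum_non_empty[OF C] n by (auto simp: spectrum_def)
  then obtain v where v: "v \<in> carrier_vec n" "v \<noteq> 0\<^sub>v n" "C *\<^sub>v v = l \<cdot>\<^sub>v v"
    using C by (auto simp: eigenvalue_def eigenvector_def)
  define N2 where "N2 = (\<Sum>i<n. (cmod (v $ i))\<^sup>2)"
  have "\<exists>i<n. v $ i \<noteq> 0"
  proof (rule ccontr)
    assume "\<not> (\<exists>i<n. v $ i \<noteq> 0)"
    then have "v = 0\<^sub>v n" using v(1) by (intro eq_vecI) auto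
    then show False using v(2) by simp
  qed
  then obtain i where i: "i < n" "v $ i \<noteq> 0" by auto
  have "0 < (cmod (v $ i))\<^sup>2" using i by simp
  also have "\<dots> \<le> N2" unfolding N2_def using i by (intro member_le_sum) auto
  finally have N2: "0 < N2" .
  have row: "(\<Sum>j<n. complex_of_real (A $$ (i, j)) * v $ j) = l * v $ i" if "i < n" for i
  proof -
    have "(C *\<^sub>v v) $ i = l * v $ i" using v that by simp
    moreover have "(C *\<^sub>v v) $ i = (\<Sum>j<n. complex_of_real (A $$ (i, j)) * v $ j)"
      using A C v(1) that by (simp add: C_def scalar_prod_def atLeast0LessThan)
    ultimately show ?thesis by simp
  qed
  define q where "q = (\<Sum>i<n. \<Sum>j<n. cnj (v $ i) * complex_of_real (A $$ (i, j)) * v $ j)"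
  have "q = (\<Sum>i<n. cnj (v $ i) * (l * v $ i))"
    unfolding q_def using row by (intro sum.cong) (auto simp: sum_distrib_left[symmetric] mult.assoc)
  also have "\<dots> = (\<Sum>i<n. l * complex_of_real ((cmod (v $ i))\<^sup>2))"
    by (intro sum.cong) (simp_all only: complex_norm_square mult_ac)
  also have "\<dots> = l * complex_of_real N2" by (simp add: N2_def sum_distrib_left)
  finally have q: "q = l * complex_of_real N2" .
  \<comment> \<open>By symmetry, conjugation merely exchanges the two summation indices.\<close>
  have "cnj q = (\<Sum>i<n. \<Sum>j<n. cnj (v $ j) * complex_of_real (A $$ (i, j)) * v $ i)"
    unfolding q_def by (simp add: mult_ac)
  also have "\<dots> = (\<Sum>j<n. \<Sum>i<n. cnj (v $ j) * complex_of_real (A $$ (i, j)) * v $ i)"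
    by (rule sum.swap)
  also have "\<dots> = q" unfolding q_def using sym by (intro sum.cong) auto
  finally have "cnj l = l" using q N2 by auto
  then have "l \<in> \<real>" by (simp add: Reals_cnj_iff)
  then obtain r where r: "l = complex_of_real r" by (rule Reals_cases)
  \<comment> \<open>\<open>A\<close> and \<open>C\<close> share their characteristic polynomial, so
    its real root is an eigenvalue of \<open>A\<close> over the reals.\<close>
  have "poly (char_poly C) l = 0" using l eigenvalue_root_char_poly[OF C] by simp
  then have "complex_of_real (poly (char_poly A) r) = 0"
    unfolding C_def of_real_hom.char_poly_hom[OF A] r by simp
  then show ?thesis unfolding spectrum_root_char_poly[OF A] by auto
qed

section \<open>Submatrices and index sets\<close>

text \<open>The inverse sends j to its rank card {a \<in> N. a < j}; \<open>entries_surj\<close>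
  uses the same rank to extend a vector to a function.\<close>

lemma bij_betw_pick:
  assumes "finite N"
  shows "bij_betw (pick N) {..<card N} N"
  unfolding bij_betw_def
proof
  show "inj_on (pick N) {..<card N}"
  proof (rule inj_onI)
    fix i j assume "i \<in> {..<card N}" "j \<in> {..<card N}" and eq: "pick N i = pick N j"
    then show "i = j"
      using card_pick_le[of i N] card_pick_le[of j N] unfolding eq by simp
  qed
  show "pick N ` {..<card N} = N"
  proof
    show "pick N ` {..<card N} \<subseteq> N" using pick_in_set_le by auto
    show "N \<subseteq> pick N ` {..<card N}"
    proof
      fix j assume j: "j \<in> N"
      have "card {a \<in> N. a < j} < card N"
        using assms j by (intro psubset_card_mono) auto
      then show "j \<in> pick N ` {..<card N}"
        using pick_card_in_set[OF j] by (intro image_eqI[of _ _ "card {a \<in> N. a < j}"]) auto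
    qed
  qed
qed

lemma entries_carrier [simp]: "entries x N \<in> carrier_vec (card N)"
  by (simp add: entries_def)

lemma entries_index: "i < card N \<Longrightarrow> entries x N $ i = x (pick N i)"
  by (simp add: entries_def)

lemma entries_cong: "(\<And>j. j \<in> N \<Longrightarrow> x j = y j) \<Longrightarrow> entries x N = entries y N"
  unfolding entries_def by (intro eq_vecI) (simp_all add: pick_in_set_le)

lemma entries_surj:
  assumes "v \<in> carrier_vec (card N)"
  shows "\<exists>x. v = entries x N"
  using assms by (intro exI[of _ "\<lambda>j. v $ card {a \<in> N. a < j}"] eq_vecI)
    (simp_all add: entries_def card_pick_le)

lemma sum_pick: "finite N \<Longrightarrow> (\<Sum>i<card N. h (pick N i)) = (\<Sum>j\<in>N. h j)"
  using sum.reindex_bij_betw[OF bij_betw_pick] .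

lemma scalar_prod_entries:
  assumes "finite N"
  shows "entries x N \<bullet> entries y N = (\<Sum>j\<in>N. x j * y j)"
  using sum_pick[OF assms, of "\<lambda>j. x j * y j"]
  by (simp add: scalar_prod_def entries_def atLeast0LessThan)

text \<open>Defined for all indices, unlike \<open>Gram\<close>, hence symmetric without range
  conditions.\<close>

definition gram :: "'a measure \<Rightarrow> (nat \<Rightarrow> 'a \<Rightarrow> real) \<Rightarrow> nat \<Rightarrow> nat \<Rightarrow> real" where
  "gram Q \<psi> j k = ipQ Q (\<psi> j) (\<psi> k)"

lemma gram_sym: "gram Q \<psi> j k = gram Q \<psi> k j"
  by (simp add: gram_def ipQ_def mult.commute)

lemma submatrix_Gram:
  assumes "I \<subseteq> {..<p}" "J \<subseteq> {..<p}"
  shows "submatrix (Gram Q p \<psi>) I J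
    = mat (card I) (card J) (\<lambda>(i, j). gram Q \<psi> (pick I i) (pick J j))"
proof -
  have 1: "{i. i < p \<and> i \<in> I} = I" "{i. i < p \<and> i \<in> J} = J" using assms by auto
  have "pick I i < p" if "i < card I" for i using pick_in_set_le[OF that] assms by auto
  moreover have "pick J i < p" if "i < card J" for i using pick_in_set_le[OF that] assms by auto
  ultimately show ?thesis
    unfolding submatrix_def by (intro eq_matI) (simp_all add: Gram_def gram_def 1)
qed

text \<open>The bridge from matrices to functions: I = J = N gives \<open>Sigma11\<close>, the
  complement of \<open>N\<close> as \<open>I\<close> gives \<open>Sigma21\<close>.\<close>

lemma submatrix_Gram_entries:
  assumes "I \<subseteq> {..<p}" "J \<subseteq> {..<p}"
  shows "submatrix (Gram Q p \<psi>) I J *\<^sub>v entries x J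
    = entries (mapp p (gram Q \<psi>) (cutoff x J)) I"
proof (rule eq_vecI)
  have fJ: "finite J" using assms finite_subset by auto
  fix i assume "i < dim_vec (entries (mapp p (gram Q \<psi>) (cutoff x J)) I)"
  then have i: "i < card I" by (simp add: entries_def)
  have "(submatrix (Gram Q p \<psi>) I J *\<^sub>v entries x J) $ i
      = (\<Sum>j<card J. gram Q \<psi> (pick I i) (pick J j) * x (pick J j))"
    using i by (simp add: submatrix_Gram[OF assms] scalar_prod_def entries_def atLeast0LessThan)
  also have "\<dots> = (\<Sum>j\<in>J. gram Q \<psi> (pick I i) j * x j)" by (rule sum_pick[OF fJ])
  also have "\<dots> = mapp p (gram Q \<psi>) (cutoff x J) (pick I i)"
    unfolding mapp_def cutoff_def using assms(2) by (intro sum.mono_neutral_cong_left) auto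
  finally show "(submatrix (Gram Q p \<psi>) I J *\<^sub>v entries x J) $ i
      = entries (mapp p (gram Q \<psi>) (cutoff x J)) I $ i"
    using i by (simp add: entries_index)
qed (simp add: submatrix_Gram[OF assms] entries_def)

lemma Sigma11_carrier:
  "N \<subseteq> {..<p} \<Longrightarrow> Sigma11 Q p \<psi> N \<in> carrier_mat (card N) (card N)"
  by (simp add: Sigma11_def submatrix_Gram)

lemma entries_quadratic_form:
  assumes "N \<subseteq> {..<p}"
  shows "entries x N \<bullet> (Sigma11 Q p \<psi> N *\<^sub>v entries x N)
    = bform p (gram Q \<psi>) (cutoff x N) (cutoff x N)"
proof -
  have "finite N" using assms finite_subset by auto
  then show ?thesis
    using assms by (simp add: Sigma11_def submatrix_Gram_entries scalar_prod_entries bform_cutoff_left)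
qed

lemma scalar_prod_entries_self:
  "finite N \<Longrightarrow> entries x N \<bullet> entries x N = (L2_set x N)\<^sup>2"
  by (simp add: scalar_prod_entries L2_set_square flip: power2_eq_square)

text \<open>Rayleigh quotient: at an eigenvector the form equals the eigenvalue times the squared
  norm.\<close>

lemma Lambda_ge:
  assumes N: "N \<subseteq> {..<p}" "N \<noteq> {}"
    and lower: "\<And>x. c * (L2_set x N)\<^sup>2 \<le> bform p (gram Q \<psi>) (cutoff x N) (cutoff x N)"
  shows "sqrt c \<le> Lambda Q p \<psi> N"
proof -
  let ?A = "Sigma11 Q p \<psi> N"
  have fN: "finite N" using N(1) finite_subset by auto
  note A = Sigma11_carrier[OF N(1), of Q \<psi>]
  have "spectrum ?A \<noteq> {}"
  proof (rule symmetric_real_spectrum_nonempty[OF A])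
    show "0 < card N" using N fN by auto
    show "?A $$ (i, j) = ?A $$ (j, i)" if "i < card N" "j < card N" for i j
      using that by (simp add: Sigma11_def submatrix_Gram[OF N(1) N(1)] gram_sym)
  qed
  moreover have "c \<le> l" if l: "l \<in> spectrum ?A" for l
  proof -
    obtain v where v: "v \<in> carrier_vec (card N)" "v \<noteq> 0\<^sub>v (card N)" "?A *\<^sub>v v = l \<cdot>\<^sub>v v"
      using l A by (auto simp: spectrum_def eigenvalue_def eigenvector_def)
    obtain x where x: "v = entries x N" using entries_surj v(1) by blast
    have pos: "0 < (L2_set x N)\<^sup>2"
    proof (rule ccontr)
      assume "\<not> 0 < (L2_set x N)\<^sup>2"
      then have "L2_set x N = 0" by simp
      then have "x j = 0" if "j \<in> N" for j using fN that by (simp add: L2_set_eq_0_iff)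
      then have "v = 0\<^sub>v (card N)" unfolding x
        by (intro eq_vecI) (auto simp: entries_def pick_in_set_le)
      then show False using v(2) by simp
    qed
    have "c * (L2_set x N)\<^sup>2 \<le> v \<bullet> (?A *\<^sub>v v)"
      using lower[of x] entries_quadratic_form[OF N(1), of x Q \<psi>] x by simp
    also have "\<dots> = l * (L2_set x N)\<^sup>2"
      unfolding v(3) using v(1) scalar_prod_entries_self[OF fN, of x] by (simp add: x)
    finally show ?thesis using pos by simp
  qed
  ultimately have "c \<le> Min (spectrum ?A)" using card_finite_spectrum(1)[OF A] by simp
  then show ?thesis by (simp add: Lambda_def)
qed

text \<open>A nonzero kernel vector would make the form vanish.\<close>

lemma mat_inverse_of_pos_definite:
  assumes N: "N \<subseteq> {..<p}" and "0 < c"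
    and lower: "\<And>x. c * (L2_set x N)\<^sup>2 \<le> bform p (gram Q \<psi>) (cutoff x N) (cutoff x N)"
  shows "\<exists>B. mat_inverse (Sigma11 Q p \<psi> N) = Some B \<and>
    Sigma11 Q p \<psi> N * B = 1\<^sub>m (card N) \<and> B * Sigma11 Q p \<psi> N = 1\<^sub>m (card N) \<and>
    B \<in> carrier_mat (card N) (card N)"
proof -
  let ?A = "Sigma11 Q p \<psi> N"
  have fN: "finite N" using N(1) finite_subset by auto
  note A = Sigma11_carrier[OF N(1), of Q \<psi>]
  have "det ?A \<noteq> 0"
  proof
    assume "det ?A = 0"
    then obtain v where v: "v \<in> carrier_vec (card N)" "v \<noteq> 0\<^sub>v (card N)" "?A *\<^sub>v v = 0\<^sub>v (card N)"
      using det_0_iff_vec_prod_zero[OF A] by auto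
    obtain x where x: "v = entries x N" using entries_surj v(1) by blast
    have "v \<bullet> (?A *\<^sub>v v) = 0" unfolding v(3) using v(1) by simp
    then have "c * (L2_set x N)\<^sup>2 \<le> 0"
      using lower[of x] entries_quadratic_form[OF N(1), of x Q \<psi>] x by simp
    then have "L2_set x N = 0" using \<open>0 < c\<close> by (simp add: mult_le_0_iff)
    then have "x j = 0" if "j \<in> N" for j using fN that by (simp add: L2_set_eq_0_iff)
    then have "v = 0\<^sub>v (card N)" unfolding x
      by (intro eq_vecI) (auto simp: entries_def pick_in_set_le)
    then show False using v(2) by simp
  qed
  then have "mat_inverse ?A \<noteq> None"
    using mat_inverse(1)[OF A, where b = "()"] det_non_zero_imp_unit[OF A, where b = "()"] by blast
  then show ?thesis using mat_inverse(2)[OF A] by blast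
qed

section \<open>Dictionaries in \<open>L\<^sub>2(Q)\<close>\<close>

lemma restr_carrier [simp]: "\<beta> \<in> carrier_vec p \<Longrightarrow> restr \<beta> N \<in> carrier_vec p"
  by (intro carrier_vecI) (simp add: restr_def)

lemma restr_index: "\<beta> \<in> carrier_vec p \<Longrightarrow> j < p \<Longrightarrow> restr \<beta> N $ j = cutoff (vec_index \<beta>) N j"
  by (auto simp: restr_def cutoff_def)

lemma norm2_eq: "\<beta> \<in> carrier_vec p \<Longrightarrow> norm2 \<beta> = L2_set (vec_index \<beta>) {..<p}"
  by (auto simp: norm2_def L2_set_def scalar_prod_def power2_eq_square atLeast0LessThan)

lemma norm2_restr:
  assumes "\<beta> \<in> carrier_vec p" "N \<subseteq> {..<p}"
  shows "norm2 (restr \<beta> N) = L2_set (vec_index \<beta>) N"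
proof -
  have "norm2 (restr \<beta> N) = L2_set (cutoff (vec_index \<beta>) N) {..<p}"
    unfolding norm2_eq[OF restr_carrier[OF assms(1)]]
    using assms by (intro L2_set_cong) (auto simp: restr_index)
  then show ?thesis using assms(2) by (simp add: L2_set_cutoff)
qed

lemma norm1_restr:
  assumes "\<beta> \<in> carrier_vec p" "N \<subseteq> {..<p}"
  shows "norm1 (restr \<beta> N) = (\<Sum>j\<in>N. \<bar>\<beta> $ j\<bar>)"
proof -
  have "norm1 (restr \<beta> N) = (\<Sum>j<p. \<bar>restr \<beta> N $ j\<bar>)"
    using assms by (simp add: norm1_def restr_def)
  also have "\<dots> = (\<Sum>j\<in>N. \<bar>\<beta> $ j\<bar>)"
    using assms by (intro sum.mono_neutral_cong_right) (auto simp: restr_def)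
  finally show ?thesis .
qed

lemma norm_inf_le_iff:
  assumes "0 \<le> c"
  shows "norm_inf v \<le> c \<longleftrightarrow> (\<forall>j<dim_vec v. \<bar>v $ j\<bar> \<le> c)"
  using assms by (auto simp: norm_inf_def)

lemma abs_index_le_norm_inf: "j < dim_vec v \<Longrightarrow> \<bar>v $ j\<bar> \<le> norm_inf v"
  by (auto simp: norm_inf_def)

lemma normQ_square: "(normQ Q f)\<^sup>2 = ipQ Q f f"
  by (simp add: normQ_def ipQ_def)

context
  fixes Q :: "'a measure" and p :: nat and \<psi> :: "nat \<Rightarrow> 'a \<Rightarrow> real"
  assumes dict: "L2_dictionary Q p \<psi>"
begin

lemma integrable_mult_dictionary:
  assumes "j < p" "k < p"
  shows "integrable Q (\<lambda>x. \<psi> j x * \<psi> k x)"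
proof (rule Bochner_Integration.integrable_bound)
  show "integrable Q (\<lambda>x. (\<psi> j x)\<^sup>2 + (\<psi> k x)\<^sup>2)"
    using dict assms by (auto simp: L2_dictionary_def)
  have [measurable]: "\<psi> j \<in> borel_measurable Q" "\<psi> k \<in> borel_measurable Q"
    using dict assms by (auto simp: L2_dictionary_def)
  show "(\<lambda>x. \<psi> j x * \<psi> k x) \<in> borel_measurable Q" by measurable
  have "\<bar>a * b\<bar> \<le> a\<^sup>2 + b\<^sup>2" for a b :: real
    using sum_squares_bound[of "\<bar>a\<bar>" "\<bar>b\<bar>"]
      mult_nonneg_nonneg[OF abs_ge_zero[of a] abs_ge_zero[of b]]
    unfolding abs_mult mult.assoc power2_abs by linarith
  then show "AE x in Q. norm (\<psi> j x * \<psi> k x) \<le> norm ((\<psi> j x)\<^sup>2 + (\<psi> k x)\<^sup>2)"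
    by simp
qed

text \<open>Through this identity \<open>Q\<close> enters the quadratic-form arguments only by its
  Gram matrix.\<close>

lemma ipQ_lincomb:
  assumes "x \<in> carrier_vec p" "y \<in> carrier_vec p"
  shows "ipQ Q (lincomb_fun \<psi> x) (lincomb_fun \<psi> y) = bform p (gram Q \<psi>) (vec_index x) (vec_index y)"
proof -
  have "lincomb_fun \<psi> x \<omega> * lincomb_fun \<psi> y \<omega>
      = (\<Sum>j<p. \<Sum>k<p. x $ j * y $ k * (\<psi> j \<omega> * \<psi> k \<omega>))" for \<omega>
    using assms by (simp add: lincomb_fun_def sum_product mult_ac)
  then have "ipQ Q (lincomb_fun \<psi> x) (lincomb_fun \<psi> y)
      = (\<integral>\<omega>. (\<Sum>j<p. \<Sum>k<p. x $ j * y $ k * (\<psi> j \<omega> * \<psi> k \<omega>)) \<partial>Q)"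
    by (simp add: ipQ_def)
  also have "\<dots> = (\<Sum>j<p. \<integral>\<omega>. (\<Sum>k<p. x $ j * y $ k * (\<psi> j \<omega> * \<psi> k \<omega>)) \<partial>Q)"
    using integrable_mult_dictionary
    by (intro Bochner_Integration.integral_sum Bochner_Integration.integrable_sum
        integrable_mult_right) auto
  also have "\<dots> = (\<Sum>j<p. \<Sum>k<p. \<integral>\<omega>. x $ j * y $ k * (\<psi> j \<omega> * \<psi> k \<omega>) \<partial>Q)"
    using integrable_mult_dictionary
    by (intro sum.cong refl Bochner_Integration.integral_sum integrable_mult_right) auto
  finally have "ipQ Q (lincomb_fun \<psi> x) (lincomb_fun \<psi> y)
      = (\<Sum>j<p. \<Sum>k<p. x $ j * y $ k * ipQ Q (\<psi> j) (\<psi> k))"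
    by (simp add: ipQ_def)
  then show ?thesis
    by (simp add: bform_def mapp_def gram_def sum_distrib_left mult_ac)
qed

lemma ipQ_restr:
  assumes "x \<in> carrier_vec p" "y \<in> carrier_vec p"
  shows "ipQ Q (lincomb_fun \<psi> (restr x N)) (lincomb_fun \<psi> (restr y M))
    = bform p (gram Q \<psi>) (cutoff (vec_index x) N) (cutoff (vec_index y) M)"
  unfolding ipQ_lincomb[OF restr_carrier[OF assms(1)] restr_carrier[OF assms(2)]]
  using assms by (intro bform_cong) (simp_all add: restr_index)

lemma gram_psd: "0 \<le> bform p (gram Q \<psi>) x x"
proof -
  have "0 \<le> ipQ Q (lincomb_fun \<psi> (vec p x)) (lincomb_fun \<psi> (vec p x))"
    by (simp add: ipQ_def)
  also have "\<dots> = bform p (gram Q \<psi>) x x"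
    by (subst ipQ_lincomb) (auto intro!: bform_cong)
  finally show ?thesis .
qed

section \<open>The restricted isometry constant\<close>

definition isometry_const :: "nat \<Rightarrow> real \<Rightarrow> bool" where
  "isometry_const s d \<longleftrightarrow> (\<forall>x. \<forall>N\<subseteq>{..<p}. card N \<le> s \<longrightarrow>
    (1 - d) * (L2_set x N)\<^sup>2 \<le> bform p (gram Q \<psi>) (cutoff x N) (cutoff x N) \<and>
    bform p (gram Q \<psi>) (cutoff x N) (cutoff x N) \<le> (1 + d) * (L2_set x N)\<^sup>2)"

lemma isometry_constD:
  assumes "isometry_const s d" "N \<subseteq> {..<p}" "card N \<le> s"
  shows "(1 - d) * (L2_set x N)\<^sup>2 \<le> bform p (gram Q \<psi>) (cutoff x N) (cutoff x N)"
    and "bform p (gram Q \<psi>) (cutoff x N) (cutoff x N) \<le> (1 + d) * (L2_set x N)\<^sup>2"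
  using assms by (simp_all add: isometry_const_def)

lemma RIC_eq: "RIC Q p \<psi> s = (LEAST d. isometry_const s d)"
proof -
  have "(\<forall>\<beta>\<in>carrier_vec p. \<forall>N\<subseteq>{..<p}. card N \<le> s \<longrightarrow>
     (1 - d) * (norm2 (restr \<beta> N))\<^sup>2 \<le> (normQ Q (lincomb_fun \<psi> (restr \<beta> N)))\<^sup>2 \<and>
     (normQ Q (lincomb_fun \<psi> (restr \<beta> N)))\<^sup>2 \<le> (1 + d) * (norm2 (restr \<beta> N))\<^sup>2)
    \<longleftrightarrow> isometry_const s d" (is "?L \<longleftrightarrow> ?R") for d
  proof
    assume R: ?R
    show ?L
    proof (intro ballI allI impI)
      fix \<beta> :: "real vec" and N assume "\<beta> \<in> carrier_vec p" "N \<subseteq> {..<p}" "card N \<le> s"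
      then show "(1 - d) * (norm2 (restr \<beta> N))\<^sup>2 \<le> (normQ Q (lincomb_fun \<psi> (restr \<beta> N)))\<^sup>2 \<and>
          (normQ Q (lincomb_fun \<psi> (restr \<beta> N)))\<^sup>2 \<le> (1 + d) * (norm2 (restr \<beta> N))\<^sup>2"
        using R by (simp add: isometry_const_def normQ_square ipQ_restr norm2_restr)
    qed
  next
    assume L: ?L
    show ?R unfolding isometry_const_def
    proof (intro allI impI)
      fix x :: "nat \<Rightarrow> real" and N assume N: "N \<subseteq> {..<p}" "card N \<le> s"
      define \<beta> where "\<beta> = vec p x"
      have \<beta>: "\<beta> \<in> carrier_vec p" by (simp add: \<beta>_def)
      have 1: "norm2 (restr \<beta> N) = L2_set x N"
        unfolding norm2_restr[OF \<beta> N(1)] using N(1) by (intro L2_set_cong) (auto simp: \<beta>_def)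
      have "(normQ Q (lincomb_fun \<psi> (restr \<beta> N)))\<^sup>2
          = bform p (gram Q \<psi>) (cutoff x N) (cutoff x N)"
        unfolding normQ_square ipQ_restr[OF \<beta> \<beta>] by (intro bform_cong) (auto simp: \<beta>_def cutoff_def)
      then show "(1 - d) * (L2_set x N)\<^sup>2 \<le> bform p (gram Q \<psi>) (cutoff x N) (cutoff x N) \<and>
          bform p (gram Q \<psi>) (cutoff x N) (cutoff x N) \<le> (1 + d) * (L2_set x N)\<^sup>2"
        using L[rule_format, OF \<beta> N] unfolding 1 by simp
    qed
  qed
  then show ?thesis by (simp add: RIC_def)
qed

lemma bform_cutoff_bounded:
  assumes "N \<subseteq> {..<p}" "M \<subseteq> {..<p}"
  shows "\<bar>bform p A (cutoff x N) (cutoff y M)\<bar>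
    \<le> (\<Sum>j<p. \<Sum>k<p. \<bar>A j k\<bar>) * L2_set x N * L2_set y M"
  using bform_bounded[of p A "cutoff x N" "cutoff y M"] assms by (simp add: L2_set_cutoff)

text \<open>The least constant exists because the defining conditions are closed in \<open>d\<close>.\<close>

lemma isometry_const_RIC:
  assumes "0 < p" "1 \<le> s"
  shows "isometry_const s (RIC Q p \<psi> s)"
proof -
  define X where "X = {d. isometry_const s d}"
  define C where "C = (\<Sum>j<p. \<Sum>k<p. \<bar>gram Q \<psi> j k\<bar>)"
  have C0: "0 \<le> C" by (simp add: C_def sum_nonneg)
  \<comment> \<open>The 1 makes the lower bound nonpositive, hence trivial for a semidefinite form;
    \<open>C\<close> takes care of the upper one.\<close>
  have "isometry_const s (max C 1)"
    unfolding isometry_const_def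
  proof (intro allI impI conjI)
    fix x :: "nat \<Rightarrow> real" and N assume N: "N \<subseteq> {..<p}" "card N \<le> s"
    have "(1 - max C 1) * (L2_set x N)\<^sup>2 \<le> 0" by (intro mult_nonpos_nonneg) auto
    then show "(1 - max C 1) * (L2_set x N)\<^sup>2 \<le> bform p (gram Q \<psi>) (cutoff x N) (cutoff x N)"
      by (rule order_trans[OF _ gram_psd])
    have "bform p (gram Q \<psi>) (cutoff x N) (cutoff x N) \<le> C * (L2_set x N)\<^sup>2"
      using bform_cutoff_bounded[OF N(1) N(1), of "gram Q \<psi>" x x]
      by (simp add: C_def power2_eq_square mult.assoc)
    also have "\<dots> \<le> (1 + max C 1) * (L2_set x N)\<^sup>2" by (intro mult_right_mono) auto
    finally show "bform p (gram Q \<psi>) (cutoff x N) (cutoff x N) \<le> (1 + max C 1) * (L2_set x N)\<^sup>2" .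
  qed
  then have ne: "X \<noteq> {}" by (auto simp: X_def)
  \<comment> \<open>A singleton with entry 1 gives 1 - d \<le> 1 + d. With p = 0 or s = 0 every real
    would qualify and there would be no least one.\<close>
  have nonneg: "0 \<le> d" if "d \<in> X" for d
  proof -
    have d: "isometry_const s d" using that by (simp add: X_def)
    have "{0} \<subseteq> {..<p}" "card {0::nat} \<le> s" using assms by auto
    from isometry_constD[OF d this, of "\<lambda>_. 1"] show ?thesis by (simp add: L2_set_def)
  qed
  then have bdd: "bdd_below X" by (auto intro: bdd_belowI[of _ 0])
  have P: "isometry_const s (Inf X)"
    unfolding isometry_const_def
  proof (intro allI impI)
    fix x :: "nat \<Rightarrow> real" and N assume N: "N \<subseteq> {..<p}" "card N \<le> s"
    define L b where "L = (L2_set x N)\<^sup>2" and "b = bform p (gram Q \<psi>) (cutoff x N) (cutoff x N)"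
    have X: "(1 - d) * L \<le> b" "b \<le> (1 + d) * L" if "d \<in> X" for d
      using isometry_constD[of s d N x] that N by (simp_all add: X_def L_def b_def)
    have "(1 - Inf X) * L \<le> b \<and> b \<le> (1 + Inf X) * L"
    proof (cases "L = 0")
      case True
      obtain d where "d \<in> X" using ne by auto
      then show ?thesis using X[of d] True by simp
    next
      case False
      then have L: "0 < L" by (simp add: L_def)
      \<comment> \<open>Solved for \<open>d\<close>, both conditions are lower bounds on
        \<open>d\<close>, and these pass to the infimum.\<close>
      have "(L - b) / L \<le> Inf X"
        using X(1) L by (intro cInf_greatest[OF ne]) (simp add: pos_divide_le_eq algebra_simps)
      moreover have "(b - L) / L \<le> Inf X"
        using X(2) L by (intro cInf_greatest[OF ne]) (simp add: pos_divide_le_eq algebra_simps)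
      ultimately show ?thesis using L by (simp add: pos_divide_le_eq algebra_simps)
    qed
    then show "(1 - Inf X) * (L2_set x N)\<^sup>2 \<le> bform p (gram Q \<psi>) (cutoff x N) (cutoff x N) \<and>
        bform p (gram Q \<psi>) (cutoff x N) (cutoff x N) \<le> (1 + Inf X) * (L2_set x N)\<^sup>2"
      by (simp add: L_def b_def)
  qed
  have "(LEAST d. isometry_const s d) = Inf X"
    using P bdd by (intro Least_equality) (auto simp: X_def intro: cInf_lower)
  then show ?thesis using P RIC_eq by simp
qed

section \<open>The restricted orthogonality constants\<close>

definition ROC_quotients :: "nat \<Rightarrow> nat set \<Rightarrow> nat \<Rightarrow> real set" where
  "ROC_quotients s S n =
     {\<bar>ipQ Q (lincomb_fun \<psi> (restr \<beta> N)) (lincomb_fun \<psi> (restr \<beta> M))\<bar> /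
        (norm2 (restr \<beta> N) * norm2 (restr \<beta> M)) | N M \<beta>.
      S \<subseteq> N \<and> N \<subseteq> {..<p} \<and> card N \<le> n \<and> M \<subseteq> {..<p} - N \<and> card M \<le> s \<and>
      \<beta> \<in> carrier_vec p \<and> restr \<beta> N \<noteq> 0\<^sub>v p \<and> restr \<beta> M \<noteq> 0\<^sub>v p}"

lemma ROC_set_eq: "ROC_set Q p \<psi> s S n = Sup (insert 0 (ROC_quotients s S n))"
  by (simp add: ROC_set_def ROC_quotients_def)

lemma bdd_above_ROC_quotients: "bdd_above (insert 0 (ROC_quotients s S n))"
proof -
  define C where "C = (\<Sum>j<p. \<Sum>k<p. \<bar>gram Q \<psi> j k\<bar>)"
  have C0: "0 \<le> C" by (simp add: C_def sum_nonneg)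
  have "y \<le> C" if y: "y \<in> ROC_quotients s S n" for y
  proof -
    obtain N M \<beta> where y_eq: "y = \<bar>ipQ Q (lincomb_fun \<psi> (restr \<beta> N)) (lincomb_fun \<psi> (restr \<beta> M))\<bar> /
        (norm2 (restr \<beta> N) * norm2 (restr \<beta> M))"
      and NM: "N \<subseteq> {..<p}" "M \<subseteq> {..<p} - N" "\<beta> \<in> carrier_vec p" using y unfolding ROC_quotients_def by blast
    have M: "M \<subseteq> {..<p}" using NM by auto
    have "\<bar>ipQ Q (lincomb_fun \<psi> (restr \<beta> N)) (lincomb_fun \<psi> (restr \<beta> M))\<bar>
        \<le> C * (norm2 (restr \<beta> N) * norm2 (restr \<beta> M))"
      using bform_cutoff_bounded[OF NM(1) M] NM M
      by (simp add: ipQ_restr norm2_restr C_def mult.assoc)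
    moreover have "0 \<le> norm2 (restr \<beta> N) * norm2 (restr \<beta> M)"
      using NM M by (simp add: norm2_restr L2_set_nonneg)
    ultimately show ?thesis unfolding y_eq using C0
      by (cases "norm2 (restr \<beta> N) * norm2 (restr \<beta> M) = 0") (auto simp: divide_le_eq)
  qed
  then show ?thesis using C0 by (intro bdd_aboveI[of _ C]) auto
qed

lemma ROC_set_nonneg: "0 \<le> ROC_set Q p \<psi> s S n"
  unfolding ROC_set_eq by (intro cSup_upper bdd_above_ROC_quotients) simp

lemma ROC_set_mono:
  assumes "n \<le> m"
  shows "ROC_set Q p \<psi> s S n \<le> ROC_set Q p \<psi> s S m"
proof -
  have "ROC_quotients s S n \<subseteq> ROC_quotients s S m"
  proof
    fix y assume "y \<in> ROC_quotients s S n"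
    then show "y \<in> ROC_quotients s S m"
      unfolding ROC_quotients_def mem_Collect_eq
      by (elim exE conjE, intro exI conjI) (assumption | erule order_trans[OF _ assms])+
  qed
  then show ?thesis
    unfolding ROC_set_eq by (intro cSup_subset_mono bdd_above_ROC_quotients) auto
qed

text \<open>The definition uses one vector for both index sets; as \<open>N\<close> and
  \<open>M\<close> are disjoint, \<open>x\<close> and \<open>y\<close> can be glued into
  one.\<close>

lemma le_ROC_set:
  assumes N: "S \<subseteq> N" "N \<subseteq> {..<p}" "card N \<le> n" and M: "M \<subseteq> {..<p} - N" "card M \<le> s"
  shows "\<bar>bform p (gram Q \<psi>) (cutoff x N) (cutoff y M)\<bar>
    \<le> ROC_set Q p \<psi> s S n * L2_set x N * L2_set y M"
proof (cases "L2_set x N = 0 \<or> L2_set y M = 0")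
  case True
  have "M \<subseteq> {..<p}" using M by auto
  then show ?thesis using bform_cutoff_bounded[of N M "gram Q \<psi>" x y] N True by auto
next
  case False
  define \<beta> where "\<beta> = vec p (\<lambda>j. if j \<in> N then x j else y j)"
  have \<beta>: "\<beta> \<in> carrier_vec p" by (simp add: \<beta>_def)
  have M': "M \<subseteq> {..<p}" using M by auto
  have n: "norm2 (restr \<beta> N) = L2_set x N" "norm2 (restr \<beta> M) = L2_set y M"
    unfolding norm2_restr[OF \<beta> N(2)] norm2_restr[OF \<beta> M'] using N M
    by (auto intro!: L2_set_cong simp: \<beta>_def)
  have b: "ipQ Q (lincomb_fun \<psi> (restr \<beta> N)) (lincomb_fun \<psi> (restr \<beta> M))
      = bform p (gram Q \<psi>) (cutoff x N) (cutoff y M)"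
    unfolding ipQ_restr[OF \<beta> \<beta>] using M by (intro bform_cong) (auto simp: \<beta>_def cutoff_def)
  have "norm2 (0\<^sub>v p) = 0" by (simp add: norm2_def)
  then have nz: "restr \<beta> N \<noteq> 0\<^sub>v p" "restr \<beta> M \<noteq> 0\<^sub>v p" using n False by auto
  have pos: "0 < L2_set x N * L2_set y M" using False by (simp add: less_le L2_set_nonneg)
  have "\<bar>ipQ Q (lincomb_fun \<psi> (restr \<beta> N)) (lincomb_fun \<psi> (restr \<beta> M))\<bar> /
        (norm2 (restr \<beta> N) * norm2 (restr \<beta> M)) \<le> ROC_set Q p \<psi> s S n"
    unfolding ROC_set_eq using N M \<beta> nz unfolding ROC_quotients_def[of s S n]
    by (intro cSup_upper bdd_above_ROC_quotients[unfolded ROC_quotients_def] insertI2 CollectI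
        exI[of _ N] exI[of _ M] exI[of _ \<beta>] conjI refl)
  then show ?thesis using pos unfolding n b by (simp add: pos_divide_le_eq mult.assoc)
qed

lemma finite_ROC: "finite {ROC_set Q p \<psi> s S n | S. S \<subseteq> {..<p} \<and> card S = s}"
  by (simp add: setcompr_eq_image)

lemma ROC_set_le_ROC: "S \<subseteq> {..<p} \<Longrightarrow> card S = s \<Longrightarrow> ROC_set Q p \<psi> s S n \<le> ROC Q p \<psi> s n"
  unfolding ROC_def by (intro Max_ge finite_ROC) auto

text \<open>This lets the single bound 1/16 on the constant for 2s cover the one for s; the given
  \<open>S\<close> keeps the maximum from being over the empty set.\<close>

lemma ROC_mono:
  assumes "S \<subseteq> {..<p}" "card S = s" "n \<le> m"
  shows "ROC Q p \<psi> s n \<le> ROC Q p \<psi> s m"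
  unfolding ROC_def[of _ _ _ _ n]
proof (rule Max.boundedI[OF finite_ROC])
  fix r assume "r \<in> {ROC_set Q p \<psi> s S n | S. S \<subseteq> {..<p} \<and> card S = s}"
  then obtain S' where "r = ROC_set Q p \<psi> s S' n" "S' \<subseteq> {..<p}" "card S' = s" by auto
  then show "r \<le> ROC Q p \<psi> s m"
    using ROC_set_mono[OF assms(3), of s S'] ROC_set_le_ROC[of S' s m] by simp
qed (use assms in auto)

lemma rip_form_gram:
  assumes S: "S \<subseteq> {..<p}" "card S = s" "1 \<le> s"
    and rip: "RIC Q p \<psi> s + ROC Q p \<psi> s s + ROC Q p \<psi> s (2 * s) < 1"
  shows "rip_form p s (gram Q \<psi>) S (RIC Q p \<psi> s) (ROC Q p \<psi> s s) (ROC Q p \<psi> s (2 * s))"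
proof
  have "0 < p" using S by (cases "p = 0") auto
  note RIC = isometry_const_RIC[OF this S(3)]
  have scale: "\<bar>t\<bar> \<le> ROC Q p \<psi> s n * a * b"
    if "\<bar>t\<bar> \<le> ROC_set Q p \<psi> s S n * a * b" "0 \<le> a" "0 \<le> b" for t a b n
  proof -
    have "ROC_set Q p \<psi> s S n * a * b \<le> ROC Q p \<psi> s n * a * b"
      using that ROC_set_le_ROC[OF S(1,2)] by (intro mult_right_mono) auto
    then show ?thesis using that by linarith
  qed
  fix x y :: "nat \<Rightarrow> real" and N M :: "nat set"
  show "gram Q \<psi> j k = gram Q \<psi> k j" for j k by (rule gram_sym)
  show "0 \<le> bform p (gram Q \<psi>) x x" by (rule gram_psd)
  show "(1 - RIC Q p \<psi> s) * (L2_set x N)\<^sup>2 \<le> bform p (gram Q \<psi>) (cutoff x N) (cutoff x N)"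
    "bform p (gram Q \<psi>) (cutoff x N) (cutoff x N) \<le> (1 + RIC Q p \<psi> s) * (L2_set x N)\<^sup>2"
    if "N \<subseteq> {..<p}" "card N \<le> s"
    using isometry_constD[OF RIC that] by simp_all
  show "\<bar>bform p (gram Q \<psi>) (cutoff x S) (cutoff y M)\<bar> \<le> ROC Q p \<psi> s s * L2_set x S * L2_set y M"
    if "M \<subseteq> {..<p} - S" "card M \<le> s"
    using that S by (intro scale le_ROC_set L2_set_nonneg) auto
  show "\<bar>bform p (gram Q \<psi>) (cutoff x N) (cutoff y M)\<bar>
      \<le> ROC Q p \<psi> s (2 * s) * L2_set x N * L2_set y M"
    if "S \<subseteq> N" "N \<subseteq> {..<p}" "card N \<le> 2 * s" "M \<subseteq> {..<p} - N" "card M \<le> s"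
    using that by (intro scale le_ROC_set L2_set_nonneg) auto
  show "0 \<le> ROC Q p \<psi> s s" "0 \<le> ROC Q p \<psi> s (2 * s)"
    by (rule order_trans[OF ROC_set_nonneg ROC_set_le_ROC[OF S(1,2)]])+
qed (use S rip in auto)

end

section \<open>Transfer to phi, Lambda and the irrepresentable condition\<close>

lemma Rset_sums:
  assumes \<beta>: "\<beta> \<in> Rset p S N" and S: "S \<subseteq> {..<p}"
  shows "\<beta> \<in> carrier_vec p" "(\<Sum>j\<in>{..<p} - S. \<bar>\<beta> $ j\<bar>) \<le> (\<Sum>j\<in>S. \<bar>\<beta> $ j\<bar>)"
    "(\<Sum>j\<in>S. \<bar>\<beta> $ j\<bar>) \<noteq> 0"
  using assms norm1_restr[of \<beta> p S] norm1_restr[of \<beta> p "{..<p} - S"] by (auto simp: Rset_def)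

lemma Rset_dominates:
  assumes \<beta>: "\<beta> \<in> Rset p S N" and N: "N \<subseteq> {..<p}" and ij: "i \<in> N - S" "j \<in> {..<p} - N"
  shows "\<bar>\<beta> $ j\<bar> \<le> \<bar>\<beta> $ i\<bar>"
proof -
  have fN: "finite N" using N finite_subset by auto
  have c: "\<beta> \<in> carrier_vec p" using \<beta> by (simp add: Rset_def)
  have "\<bar>\<beta> $ j\<bar> = \<bar>restr \<beta> ({..<p} - N) $ j\<bar>" using c ij by (simp add: restr_def)
  also have "\<dots> \<le> norm_inf (restr \<beta> ({..<p} - N))"
    using c ij by (intro abs_index_le_norm_inf) (simp add: restr_def)
  also have "\<dots> \<le> Min ((\<lambda>j. \<bar>\<beta> $ j\<bar>) ` (N - S))" using \<beta> ij(1) by (auto simp: Rset_def)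
  also have "\<dots> \<le> \<bar>\<beta> $ i\<bar>" using fN ij(1) by (intro Min_le) auto
  finally show ?thesis .
qed

lemma phi_ge:
  assumes dict: "L2_dictionary Q p \<psi>" and S: "S \<subseteq> {..<p}" "S \<noteq> {}" "card S \<le> n"
    and lower: "\<And>N \<beta>. S \<subseteq> N \<Longrightarrow> N \<subseteq> {..<p} \<Longrightarrow> card N \<le> n \<Longrightarrow> \<beta> \<in> Rset p S N \<Longrightarrow>
      c * (L2_set (vec_index \<beta>) N)\<^sup>2 \<le> bform p (gram Q \<psi>) (vec_index \<beta>) (vec_index \<beta>)"
  shows "sqrt c \<le> phi Q p \<psi> S n"
  unfolding phi_def
proof (intro real_sqrt_le_mono cInf_greatest)
  \<comment> \<open>The indicator of \<open>S\<close> is admissible with N = S, so the infimum is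
    over a nonempty set.\<close>
  define \<beta> where "\<beta> = vec p (\<lambda>j. if j \<in> S then 1 else 0 :: real)"
  have fS: "finite S" using S finite_subset by auto
  have c: "\<beta> \<in> carrier_vec p" by (simp add: \<beta>_def)
  have "(\<Sum>j\<in>S. \<bar>\<beta> $ j\<bar>) = (\<Sum>j\<in>S. 1)" using S by (intro sum.cong) (auto simp: \<beta>_def)
  moreover have "(\<Sum>j\<in>{..<p} - S. \<bar>\<beta> $ j\<bar>) = 0" by (intro sum.neutral) (auto simp: \<beta>_def)
  ultimately have "\<beta> \<in> Rset p S S" using c S fS by (simp add: Rset_def norm1_restr)
  then show "{(normQ Q (lincomb_fun \<psi> \<beta>))\<^sup>2 / (norm2 (restr \<beta> N))\<^sup>2 | N \<beta>.
      S \<subseteq> N \<and> N \<subseteq> {..<p} \<and> card N \<le> n \<and> \<beta> \<in> Rset p S N} \<noteq> {}"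
    using S by blast
next
  fix y assume "y \<in> {(normQ Q (lincomb_fun \<psi> \<beta>))\<^sup>2 / (norm2 (restr \<beta> N))\<^sup>2 | N \<beta>.
      S \<subseteq> N \<and> N \<subseteq> {..<p} \<and> card N \<le> n \<and> \<beta> \<in> Rset p S N}"
  then obtain N \<beta> where y: "y = (normQ Q (lincomb_fun \<psi> \<beta>))\<^sup>2 / (norm2 (restr \<beta> N))\<^sup>2"
    and N: "S \<subseteq> N" "N \<subseteq> {..<p}" "card N \<le> n" and \<beta>: "\<beta> \<in> Rset p S N" by blast
  note r = Rset_sums[OF \<beta> S(1)]
  have fN: "finite N" using N finite_subset by auto
  \<comment> \<open>A vector in \<open>Rset\<close> is nonzero on \<open>S\<close>, so the
    denominator is positive.\<close>
  have "L2_set (vec_index \<beta>) N \<noteq> 0"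
  proof
    assume "L2_set (vec_index \<beta>) N = 0"
    then have "\<beta> $ j = 0" if "j \<in> S" for j using fN N that by (auto simp: L2_set_eq_0_iff)
    then show False using r(3) by simp
  qed
  then have "0 < (L2_set (vec_index \<beta>) N)\<^sup>2" by simp
  then show "c \<le> y"
    using lower[OF N \<beta>] ipQ_lincomb[OF dict r(1) r(1)]
    by (simp add: y normQ_square norm2_restr[OF r(1) N(2)] pos_le_divide_eq)
qed

text \<open>Membership in \<open>Rset\<close> supplies exactly the cone and domination hypotheses of
  \<open>cone_lower\<close>, which bounds phi; the isometry bound on \<open>S\<close> itself bounds
  Lambda.\<close>

lemma phi_Lambda_ge:
  assumes dict: "L2_dictionary Q p \<psi>" and form: "rip_form p s (gram Q \<psi>) S \<delta> \<theta> \<theta>'"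
  shows "(1 - \<delta> - \<theta> - \<theta>') * sqrt ((1 - \<delta>) / (1 - \<delta> - \<theta>)) \<le> phi Q p \<psi> S (2 * s) * Lambda Q p \<psi> S"
proof -
  interpret rip_form p s "gram Q \<psi>" S \<delta> \<theta> \<theta>' by (rule form)
  have S0: "S \<noteq> {}" using S by auto
  have pos: "0 < 1 - \<delta> - \<theta>" "0 < 1 - \<delta> - \<theta> - \<theta>'" "0 < 1 - \<delta>" using rip nonneg by auto
  have "sqrt \<phi>2 \<le> phi Q p \<psi> S (2 * s)"
  proof (rule phi_ge[OF dict S(1) S0])
    show "card S \<le> 2 * s" using S by simp
    fix N \<beta> assume N: "S \<subseteq> N" "N \<subseteq> {..<p}" "card N \<le> 2 * s" and \<beta>: "\<beta> \<in> Rset p S N"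
    show "\<phi>2 * (L2_set (vec_index \<beta>) N)\<^sup>2 \<le> bform p (gram Q \<psi>) (vec_index \<beta>) (vec_index \<beta>)"
      using Rset_sums[OF \<beta> S(1)] Rset_dominates[OF \<beta> N(2)] by (intro cone_lower[OF N]) auto
  qed
  moreover have "sqrt (1 - \<delta>) \<le> Lambda Q p \<psi> S"
    using S S0 by (intro Lambda_ge isometry_lower) auto
  ultimately have "sqrt \<phi>2 * sqrt (1 - \<delta>) \<le> phi Q p \<psi> S (2 * s) * Lambda Q p \<psi> S"
    using \<phi>2_pos pos by (intro mult_mono) (auto intro: order_trans[of 0 "sqrt \<phi>2"])
  moreover have "sqrt \<phi>2 * sqrt (1 - \<delta>) = (1 - \<delta> - \<theta> - \<theta>') * sqrt ((1 - \<delta>) / (1 - \<delta> - \<theta>))"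
    using pos unfolding \<phi>2_def by (simp add: real_sqrt_divide)
  ultimately show ?thesis by simp
qed

lemma mapp_uminus: "mapp p A (\<lambda>i. - x i) j = - mapp p A x j"
  by (simp add: mapp_def sum_negf)

lemma weak_irrepresentable_of_rip_form:
  assumes form: "rip_form p s (gram Q \<psi>) S \<delta> \<theta> \<theta>'"
    and small: "\<delta> \<le> sqrt 2 - 1" "\<theta> \<le> 1 / 16" "\<theta>' \<le> 1 / 16"
  shows "weak_irrepresentable Q p \<psi> S (2 * s)"
  unfolding weak_irrepresentable_def
proof
  interpret rip_form p s "gram Q \<psi>" S \<delta> \<theta> \<theta>' by (rule form)
  fix \<tau> :: "nat \<Rightarrow> real" assume \<tau>: "\<tau> \<in> S \<rightarrow> {-1, 1}"
  have "\<bar>\<tau> j\<bar> \<le> 1" if "j \<in> S" for j using \<tau> that by (auto simp: Pi_iff)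
  from weak_irrepresentable_signs[where \<tau> = \<tau>, OF small this]
  obtain N b where N: "S \<subseteq> N" "N \<subseteq> {..<p}" "card N \<le> 2 * s"
    and b: "\<forall>j. j \<notin> N \<longrightarrow> b j = 0" "\<forall>j\<in>S. grad b j = - \<tau> j"
      "\<forall>j\<in>N - S. b j \<noteq> 0 \<and> grad b j = - sgn (b j)" "\<forall>j\<in>{..<p} - N. \<bar>grad b j\<bar> \<le> 1"
    by blast
  have "0 < 1 - \<delta> - \<theta>" using rip nonneg by simp
  from mat_inverse_of_pos_definite[OF N(2) this isometry_lower_double[OF N]]
  obtain B where B: "mat_inverse (Sigma11 Q p \<psi> N) = Some B"
    "Sigma11 Q p \<psi> N * B = 1\<^sub>m (card N)" "B * Sigma11 Q p \<psi> N = 1\<^sub>m (card N)"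
    "B \<in> carrier_mat (card N) (card N)" by blast
  note A = Sigma11_carrier[OF N(2), of Q \<psi>]
  have inv: "invertible_mat (Sigma11 Q p \<psi> N)"
    unfolding invertible_mat_def inverts_mat_def using A B by auto
  \<comment> \<open>Stationarity reads A b = - \<tau> on \<open>N\<close>, so the solution of the
    linear system with right side \<tau> is - b, and sgn b extends the signs beyond
    \<open>S\<close>.\<close>
  define b' where "b' = (\<lambda>j. - b j)"
  have cb: "cutoff b' N = b'" using b(1) by (intro cutoff_idem) (auto simp: b'_def)
  define \<tau>\<^sub>2 where "\<tau>\<^sub>2 = (\<lambda>j. sgn (b j))"
  have \<tau>2: "\<tau>\<^sub>2 \<in> N - S \<rightarrow> {-1, 1}" using b(3) by (auto simp: \<tau>\<^sub>2_def sgn_if)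
  define e where "e = entries b' N"
  have e: "e \<in> carrier_vec (card N)" by (simp add: e_def)
  have "Sigma11 Q p \<psi> N *\<^sub>v e = entries (grad b') N"
    unfolding Sigma11_def e_def submatrix_Gram_entries[OF N(2) N(2)] cb ..
  also have "\<dots> = entries (\<lambda>j. if j \<in> S then \<tau> j else \<tau>\<^sub>2 j) N"
    using b(2,3) by (intro entries_cong) (auto simp: b'_def mapp_uminus \<tau>\<^sub>2_def)
  finally have "B *\<^sub>v entries (\<lambda>j. if j \<in> S then \<tau> j else \<tau>\<^sub>2 j) N = B *\<^sub>v (Sigma11 Q p \<psi> N *\<^sub>v e)"
    by simp
  also have "\<dots> = (B * Sigma11 Q p \<psi> N) *\<^sub>v e" using assoc_mult_mat_vec[OF B(4) A e] by simp
  also have "\<dots> = e" using B(3) e by simp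
  finally have solve: "the (mat_inverse (Sigma11 Q p \<psi> N)) *\<^sub>v
      entries (\<lambda>j. if j \<in> S then \<tau> j else \<tau>\<^sub>2 j) N = e" using B(1) by simp
  have "Sigma21 Q p \<psi> N *\<^sub>v e = entries (grad b') ({..<p} - N)"
    unfolding Sigma21_def e_def submatrix_Gram_entries[OF Diff_subset N(2)] cb ..
  moreover have "norm_inf (entries (grad b') ({..<p} - N)) \<le> 1"
    unfolding norm_inf_le_iff[OF zero_le_one]
  proof (intro allI impI)
    fix i assume "i < dim_vec (entries (grad b') ({..<p} - N))"
    then have i: "i < card ({..<p} - N)" by (simp add: entries_def)
    then have "pick ({..<p} - N) i \<in> {..<p} - N" by (rule pick_in_set_le)
    then show "\<bar>entries (grad b') ({..<p} - N) $ i\<bar> \<le> 1"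
      using b(4) by (simp add: entries_index[OF i] b'_def mapp_uminus)
  qed
  ultimately have "norm_inf (Sigma21 Q p \<psi> N *\<^sub>v (the (mat_inverse (Sigma11 Q p \<psi> N)) *\<^sub>v
      entries (\<lambda>j. if j \<in> S then \<tau> j else \<tau>\<^sub>2 j) N)) \<le> 1"
    unfolding solve by simp
  then show "\<exists>N. S \<subseteq> N \<and> N \<subseteq> {..<p} \<and> card N \<le> 2 * s \<and> invertible_mat (Sigma11 Q p \<psi> N) \<and>
      (\<exists>\<tau>\<^sub>2\<in>N - S \<rightarrow> {- 1, 1}. norm_inf (Sigma21 Q p \<psi> N *\<^sub>v
        (the (mat_inverse (Sigma11 Q p \<psi> N)) *\<^sub>v entries (\<lambda>j. if j \<in> S then \<tau> j else \<tau>\<^sub>2 j) N)) \<le> 1)"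
    using N inv \<tau>2 by blast
qed

theorem corollary8p1:
  fixes Q :: "'a measure" and p s :: nat and \<psi> :: "nat \<Rightarrow> 'a \<Rightarrow> real"
  assumes "L2_dictionary Q p \<psi>" and "s \<ge> 1"
  shows "(RIC Q p \<psi> s + ROC Q p \<psi> s s + ROC Q p \<psi> s (2 * s) < 1 \<longrightarrow>
           (\<forall>S. S \<subseteq> {..<p} \<and> card S = s \<longrightarrow>
              phi Q p \<psi> S (2 * s) * Lambda Q p \<psi> S
                \<ge> (1 - RIC Q p \<psi> s - ROC Q p \<psi> s s - ROC Q p \<psi> s (2 * s))
                    * sqrt ((1 - RIC Q p \<psi> s) / (1 - RIC Q p \<psi> s - ROC Q p \<psi> s s)) \<and>
              (1 - RIC Q p \<psi> s - ROC Q p \<psi> s s - ROC Q p \<psi> s (2 * s))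
                    * sqrt ((1 - RIC Q p \<psi> s) / (1 - RIC Q p \<psi> s - ROC Q p \<psi> s s))
                \<ge> 1 - RIC Q p \<psi> s - ROC Q p \<psi> s s - ROC Q p \<psi> s (2 * s) \<and>
              alpha Q p \<psi> s S
                \<le> sqrt 2 * (ROC Q p \<psi> s s + sqrt (ROC Q p \<psi> s s))
                    / (1 - RIC Q p \<psi> s - ROC Q p \<psi> s s - ROC Q p \<psi> s (2 * s)))) \<and>
         (RIC Q p \<psi> s \<le> sqrt 2 - 1 \<and> ROC Q p \<psi> s (2 * s) \<le> 1 / 16 \<longrightarrow>
           (\<forall>S. S \<subseteq> {..<p} \<and> card S = s \<longrightarrow>
              alpha Q p \<psi> s S \<le> 0.96 \<and> weak_irrepresentable Q p \<psi> S (2 * s)))"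
proof -
  define \<delta> \<theta> \<theta>' where "\<delta> = RIC Q p \<psi> s" and "\<theta> = ROC Q p \<psi> s s" and "\<theta>' = ROC Q p \<psi> s (2 * s)"
  define g where "g = 1 - \<delta> - \<theta> - \<theta>'"
  have *: "g * sqrt ((1 - \<delta>) / (1 - \<delta> - \<theta>)) \<le> phi Q p \<psi> S (2 * s) * Lambda Q p \<psi> S"
    "g \<le> g * sqrt ((1 - \<delta>) / (1 - \<delta> - \<theta>))"
    "alpha Q p \<psi> s S \<le> sqrt 2 * (\<theta> + sqrt \<theta>) / g"
    "rip_form p s (gram Q \<psi>) S \<delta> \<theta> \<theta>'"
    if S: "S \<subseteq> {..<p}" "card S = s" and rip: "\<delta> + \<theta> + \<theta>' < 1" for S
  proof -
    show form: "rip_form p s (gram Q \<psi>) S \<delta> \<theta> \<theta>'"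
      unfolding \<delta>_def \<theta>_def \<theta>'_def
      using rip_form_gram[OF assms(1) S assms(2)] rip by (simp add: \<delta>_def \<theta>_def \<theta>'_def)
    then have nn: "0 \<le> \<theta>" "0 \<le> \<theta>'" by (simp_all add: rip_form_def)
    then have g: "0 < g" "0 < 1 - \<delta> - \<theta>" "\<delta> < 1" using rip by (auto simp: g_def)
    show 1: "g * sqrt ((1 - \<delta>) / (1 - \<delta> - \<theta>)) \<le> phi Q p \<psi> S (2 * s) * Lambda Q p \<psi> S"
      unfolding g_def by (rule phi_Lambda_ge[OF assms(1) form])
    have "1 \<le> (1 - \<delta>) / (1 - \<delta> - \<theta>)" using g nn by simp
    then show 2: "g \<le> g * sqrt ((1 - \<delta>) / (1 - \<delta> - \<theta>))"
      using mult_left_mono[of 1 "sqrt ((1 - \<delta>) / (1 - \<delta> - \<theta>))" g] g by simp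
    define t where "t = ROC_set Q p \<psi> s S s"
    have t: "0 \<le> t" "t \<le> \<theta>"
      unfolding t_def \<theta>_def using assms S by (auto intro: ROC_set_nonneg ROC_set_le_ROC)
    \<comment> \<open>\<delta> < 1 gives 1 + \<delta> \<le> 2, the source of the common factor sqrt
      2.\<close>
    have "sqrt ((1 + \<delta>) * t) \<le> sqrt (2 * \<theta>)"
      using t g mult_right_mono[of "1 + \<delta>" 2 t] by (intro real_sqrt_le_mono) linarith
    then have num: "sqrt 2 * t + sqrt ((1 + \<delta>) * t) \<le> sqrt 2 * (\<theta> + sqrt \<theta>)"
      unfolding distrib_left using t(2)
      by (intro add_mono mult_left_mono) (simp_all add: real_sqrt_mult)
    show "alpha Q p \<psi> s S \<le> sqrt 2 * (\<theta> + sqrt \<theta>) / g"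
      unfolding alpha_def t_def[symmetric] \<delta>_def[symmetric]
      using num order_trans[OF 2 1] g nn by (intro frac_le) auto
  qed
  have "alpha Q p \<psi> s S \<le> 0.96 \<and> weak_irrepresentable Q p \<psi> S (2 * s)"
    if S: "S \<subseteq> {..<p}" "card S = s" and small: "\<delta> \<le> sqrt 2 - 1" "\<theta>' \<le> 1 / 16" for S
  proof -
    have \<theta>: "\<theta> \<le> 1 / 16"
      using ROC_mono[OF assms(1) S, of s "2 * s"] small by (simp add: \<theta>_def \<theta>'_def)
    then have rip: "\<delta> + \<theta> + \<theta>' < 1" using small sqrt2_less by simp
    note ** = *[OF S rip]
    have "0 \<le> \<theta>" using **(4) by (simp add: rip_form_def)
    have "sqrt \<theta> \<le> sqrt ((1 / 4)\<^sup>2)" using \<theta> by (intro real_sqrt_le_mono) (simp add: power2_eq_square)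
    then have "\<theta> + sqrt \<theta> \<le> 5 / 16" using \<theta> by simp
    \<comment> \<open>1 - (sqrt 2 - 1) - 2/16 = 1.875 - sqrt 2.\<close>
    moreover have g: "1.875 - sqrt 2 \<le> g" "0 < 1.875 - sqrt 2"
      using \<theta> small sqrt2_less by (auto simp: g_def)
    ultimately have "sqrt 2 * (\<theta> + sqrt \<theta>) / g \<le> sqrt 2 * (5 / 16) / (1.875 - sqrt 2)"
      by (intro frac_le mult_left_mono) auto
    \<comment> \<open>Equivalent to 1.2725 * sqrt 2 \<le> 1.8, where the left side is about 1.7996;
      hence the several decimals in \<open>sqrt2_less\<close>.\<close>
    also have "\<dots> \<le> 0.96" using g sqrt2_less by (simp add: pos_divide_le_eq)
    finally have "alpha Q p \<psi> s S \<le> 0.96" by (rule order_trans[OF **(3)])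
    then show ?thesis
      using weak_irrepresentable_of_rip_form[OF **(4) small(1) \<theta> small(2)] by simp
  qed
  with * show ?thesis by (auto simp: g_def \<delta>_def \<theta>_def \<theta>'_def)
qed

end
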